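(* Let $\mathsf P$ be a piece with basic move set $\mathcal M$ and let $\mathcal B$ be a rational convex polygon. For each positive integer $q$, the number $u_{\mathsf P}(q;n)$ of nonattacking unlabelled configurations of $q$ pieces $\mathsf P$ in the dilated board $t\mathcal B$, $t=n+1$, is given by a quasipolynomial function of $t$, of degree $2q$, with leading coefficient $(\operatorname{vol}\mathcal B)^q/q!$.
   Context: A piece $\mathsf P$ is specified by a nonempty finite set $\mathcal M$ of basic moves: nonzero vectors $m=(c,d)\in\mathbb Z^2$ with $\gcd(c,d)=1$, no two of which are parallel; put $m^\perp=(d,-c)$. $\mathcal B\subset\mathbb R^2$ is a closed two-dimensional convex polygon with rational vertices, $\mathcal B^\circ$ its interior, and $\operatorname{vol}\mathcal B$ its area. For a positive integer $t=n+1$, a labelled configuration of $q$ pieces is $\mathbf z=(z_1,\dots,z_q)$ with each $z_i\in t\mathcal B^\circ\cap\mathbb Z^2$; it is nonattacking if for all $i\ne j$ and all $m\in\mathcal M$, $(z_j-z_i)\cdot m^\perp\neq 0$ (i.e. $z_j-z_i$ is not a multiple of $m$; in particular $z_i\ne z_j$). $o_{\mathsf P}(q;n)$ is the number of nonattacking labelled configurations and $u_{\mathsf P}(q;n)=o_{\mathsf P}(q;n)/q!$ is the number of nonattacking unlabelled configurations (multisets of positions). A quasipolynomial is a function $f$ of positive integers of the form $f(t)=\sum_{j=0}^{D}e_j(t)t^j$ with each $e_j$ periodic; its degree is the highest degree of its constituent polynomials. *)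

theory Defs
  imports "HOL-Analysis.Analysis" "HOL-Computational_Algebra.Polynomial"
    "HOL-Combinatorics.Multiset_Permutations"
begin

type_synonym lattice_point = "int \<times> int"

definition dot :: "lattice_point \<Rightarrow> lattice_point \<Rightarrow> int" where
  "dot a b = fst a * fst b + snd a * snd b"

definition perp :: "lattice_point \<Rightarrow> lattice_point" where
  "perp m = (snd m, - fst m)"

text \<open>A piece is given by its set of basic moves.  Two moves are parallel iff
  one is orthogonal to the perpendicular of the other.\<close>

definition piece :: "lattice_point set \<Rightarrow> bool" where
  "piece M \<longleftrightarrow> finite M \<and> M \<noteq> {} \<and>
     (\<forall>m\<in>M. m \<noteq> 0 \<and> gcd (fst m) (snd m) = 1) \<and>
     (\<forall>m\<in>M. \<forall>m'\<in>M. m \<noteq> m' \<longrightarrow> dot m (perp m') \<noteq> 0)"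

definition rational_convex_polygon :: "(real \<times> real) set \<Rightarrow> bool" where
  "rational_convex_polygon B \<longleftrightarrow> polytope B \<and> aff_dim B = 2 \<and>
     (\<forall>v. v extreme_point_of B \<longrightarrow> fst v \<in> \<rat> \<and> snd v \<in> \<rat>)"

definition board_points :: "(real \<times> real) set \<Rightarrow> nat \<Rightarrow> lattice_point set" where
  "board_points B t =
     {p. (of_int (fst p), of_int (snd p)) \<in> (\<lambda>x. real t *\<^sub>R x) ` interior B}"

definition labelled_configs ::
    "lattice_point set \<Rightarrow> (real \<times> real) set \<Rightarrow> nat \<Rightarrow> nat \<Rightarrow> lattice_point list set" where
  "labelled_configs M B q n =
     {z. length z = q \<and> set z \<subseteq> board_points B (n + 1) \<and>
         (\<forall>i<q. \<forall>j<q. i \<noteq> j \<longrightarrow> (\<forall>m\<in>M. dot (z ! j - z ! i) (perp m) \<noteq> 0))}"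

definition o_count :: "lattice_point set \<Rightarrow> (real \<times> real) set \<Rightarrow> nat \<Rightarrow> nat \<Rightarrow> nat" where
  "o_count M B q n = card (labelled_configs M B q n)"

definition u_count :: "lattice_point set \<Rightarrow> (real \<times> real) set \<Rightarrow> nat \<Rightarrow> nat \<Rightarrow> real" where
  "u_count M B q n = real (o_count M B q n) / fact q"

definition unlabelled_configs ::
    "lattice_point set \<Rightarrow> (real \<times> real) set \<Rightarrow> nat \<Rightarrow> nat \<Rightarrow> lattice_point multiset set" where
  "unlabelled_configs M B q n = mset ` labelled_configs M B q n"

lemma finite_board_points:
  assumes "bounded B"
  shows "finite (board_points B t)"
proof -
  have "bounded ((\<lambda>x. real t *\<^sub>R x) ` interior B)"
    using assms bounded_interior bounded_scaling by blast
  then obtain K where K: "\<And>x. x \<in> (\<lambda>x. real t *\<^sub>R x) ` interior B \<Longrightarrow> norm x \<le> K"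
    unfolding bounded_iff by blast
  have "board_points B t \<subseteq> {- \<lceil>K\<rceil>..\<lceil>K\<rceil>} \<times> {- \<lceil>K\<rceil>..\<lceil>K\<rceil>}"
  proof
    fix p assume "p \<in> board_points B t"
    then have n: "norm (real_of_int (fst p), real_of_int (snd p)) \<le> K"
      using K unfolding board_points_def by blast
    have "\<bar>real_of_int (fst p)\<bar> \<le> K" "\<bar>real_of_int (snd p)\<bar> \<le> K"
      using n norm_fst_le[of "real_of_int (fst p)" "real_of_int (snd p)"]
        norm_snd_le[of "real_of_int (snd p)" "real_of_int (fst p)"] by auto
    then have "fst p \<in> {- \<lceil>K\<rceil>..\<lceil>K\<rceil>}" "snd p \<in> {- \<lceil>K\<rceil>..\<lceil>K\<rceil>}"
      by (simp_all, linarith+)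
    then show "p \<in> {- \<lceil>K\<rceil>..\<lceil>K\<rceil>} \<times> {- \<lceil>K\<rceil>..\<lceil>K\<rceil>}"
      by (simp add: mem_Times_iff)
  qed
  then show ?thesis
    by (rule finite_subset) simp
qed

lemma labelled_configs_eq:
  assumes "M \<noteq> {}"
  shows "labelled_configs M B q n =
    {z. length z = q \<and> distinct z \<and> set z \<subseteq> board_points B (n + 1) \<and>
        (\<forall>x\<in>set z. \<forall>y\<in>set z. x \<noteq> y \<longrightarrow> (\<forall>m\<in>M. dot (y - x) (perp m) \<noteq> 0))}"
    (is "_ = ?R")
proof (intro set_eqI iffI)
  fix z assume z: "z \<in> labelled_configs M B q n"
  obtain m where m: "m \<in> M" using assms by blast
  have "distinct z"
    unfolding distinct_conv_nth
  proof (intro allI impI notI)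
    fix i j assume "i < length z" "j < length z" "i \<noteq> j" "z ! i = z ! j"
    then have "dot (z ! j - z ! i) (perp m) \<noteq> 0"
      using z m unfolding labelled_configs_def by blast
    then show False using \<open>z ! i = z ! j\<close> by (simp add: dot_def)
  qed
  moreover have "\<forall>x\<in>set z. \<forall>y\<in>set z. x \<noteq> y \<longrightarrow> (\<forall>m\<in>M. dot (y - x) (perp m) \<noteq> 0)"
  proof (intro ballI impI)
    fix x y m assume "x \<in> set z" "y \<in> set z" "x \<noteq> y" "m \<in> M"
    then show "dot (y - x) (perp m) \<noteq> 0"
      using z unfolding labelled_configs_def in_set_conv_nth by blast
  qed
  ultimately show "z \<in> ?R" using z unfolding labelled_configs_def by simp
next
  fix z assume "z \<in> ?R"
  then show "z \<in> labelled_configs M B q n"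
    unfolding labelled_configs_def by (simp add: nth_eq_iff_index_eq)
qed

text \<open>The quotient \<open>u_count\<close> is the number of unlabelled configurations.\<close>

lemma u_count_eq_card_unlabelled_configs:
  assumes "M \<noteq> {}" and "bounded B"
  shows "u_count M B q n = real (card (unlabelled_configs M B q n))"
proof -
  let ?L = "labelled_configs M B q n" and ?U = "unlabelled_configs M B q n"
  have "finite ?L"
  proof (rule finite_subset)
    show "?L \<subseteq> {z. set z \<subseteq> board_points B (n + 1) \<and> length z = q}"
      unfolding labelled_configs_def by blast
  qed (rule finite_lists_length_eq[OF finite_board_points[OF assms(2)]])
  then have finU: "finite ?U" unfolding unlabelled_configs_def by simp
  have perm: "permutations_of_multiset A \<subseteq> ?L \<and> card (permutations_of_multiset A) = fact q"
    if A: "A \<in> ?U" for A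
  proof -
    obtain z where z: "z \<in> ?L" "A = mset z"
      using A unfolding unlabelled_configs_def by blast
    have eqz: "length z = q" "distinct z"
      using z labelled_configs_eq[OF assms(1)] by auto
    have "w \<in> ?L" if "w \<in> permutations_of_multiset A" for w
    proof -
      have w: "mset w = mset z" using that z by (simp add: permutations_of_multiset_def)
      have "length w = length z" "set w = set z" "distinct w \<longleftrightarrow> distinct z"
        using w mset_eq_length mset_eq_setD mset_eq_imp_distinct_iff by metis+
      then show ?thesis
        using z(1) unfolding labelled_configs_eq[OF assms(1)] by simp
    qed
    moreover have "permutations_of_multiset A = permutations_of_set (set z)"
      using eqz z by (simp add: permutations_of_set_altdef mset_set_set)
    then have "card (permutations_of_multiset A) = fact q"
      using eqz by (simp add: distinct_card)
    ultimately show ?thesis by blast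
  qed
  have "?L = (\<Union>A\<in>?U. permutations_of_multiset A)"
    using perm by (force simp: unlabelled_configs_def permutations_of_multiset_def)
  then have "card ?L = (\<Sum>A\<in>?U. card (permutations_of_multiset A))"
    using finU
    by (simp, intro card_UN_disjoint)
      (auto simp: permutations_of_multisetD, auto simp: permutations_of_multiset_def)
  also have "\<dots> = card ?U * fact q" using perm by simp
  finally show ?thesis by (simp add: u_count_def o_count_def)
qed

definition periodic :: "(nat \<Rightarrow> real) \<Rightarrow> bool" where
  "periodic e \<longleftrightarrow> (\<exists>p>0. \<forall>t. e (t + p) = e t)"

text \<open>The function \<open>f\<close> is a quasipolynomial function of positive integers with
  coefficient functions \<open>e 0, \<dots>, e D\<close>.  The value of \<open>f\<close> at 0 is irrelevant.\<close>

definition quasipolynomial_rep :: "nat \<Rightarrow> (nat \<Rightarrow> nat \<Rightarrow> real) \<Rightarrow> (nat \<Rightarrow> real) \<Rightarrow> bool" where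
  "quasipolynomial_rep D e f \<longleftrightarrow> (\<forall>j\<le>D. periodic (e j)) \<and>
     (\<forall>t>0. f t = (\<Sum>j\<le>D. e j t * real t ^ j))"

text \<open>The constituent for the residue class of \<open>r\<close> modulo a common period; all
  constituents occur as \<open>r\<close> ranges over the natural numbers.\<close>

definition constituent :: "nat \<Rightarrow> (nat \<Rightarrow> nat \<Rightarrow> real) \<Rightarrow> nat \<Rightarrow> real poly" where
  "constituent D e r = (\<Sum>j\<le>D. monom (e j r) j)"

text \<open>The maximum is over a set of numbers bounded by \<open>D\<close>, hence over a finite set.\<close>

definition quasipolynomial_degree :: "nat \<Rightarrow> (nat \<Rightarrow> nat \<Rightarrow> real) \<Rightarrow> nat" where
  "quasipolynomial_degree D e = Max (range (\<lambda>r. degree (constituent D e r)))"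

end

theory Submission
  imports Defs
begin

text \<open>
Attach to a configuration the \<open>2q\<close> integer coordinates of its pieces. It is nonattacking and lies
in the dilated board iff finitely many homogeneous integer linear inequalities and inequations in
these coordinates and \<open>t\<close> hold, because the edges of the polygon lie on rational lines. So
\<open>o_count\<close> is a sum of an indicator function over a box of size proportional to \<open>t\<close>. The
coordinates are summed out one at a time, as in Fourier-Motzkin elimination: the algebra
    generated by
linear forms, functions of linear forms modulo \<open>N\<close>, and indicators of linear inequalities is closed
under summation over one variable. Once only \<open>t\<close> is left, homogeneity makes the sign of every linear
form constant on \<open>t > 0\<close>, and a quasipolynomial remains, without exceptions for small \<open>t\<close>.

For the leading term, dominated convergence shows that the board has asymptotically \<open>vol B * t^2\<close>
points, while prescribing one attack confines a piece to a line and so costs a factor of order \<open>t\<close>.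
Hence \<open>o_count / t^(2q)\<close> tends to \<open>(vol B)^q\<close>, which determines the degree and the
leading coefficient of each constituent separately.
\<close>

subsection \<open>Univariate quasipolynomials\<close>

text \<open>Defined on all integers, because the argument will be the value of a linear form of
  either sign, such as the lower end of a summation range.\<close>

definition quasipoly :: "(int \<Rightarrow> real) \<Rightarrow> bool" where
  "quasipoly u \<longleftrightarrow> (\<exists>N>0. \<exists>p. \<forall>x. u x = poly (p (x mod N)) (of_int x))"

lemma quasipolyI: "N > 0 \<Longrightarrow> (\<And>x. u x = poly (p (x mod N)) (of_int x)) \<Longrightarrow> quasipoly u"
  unfolding quasipoly_def by blast

lemma quasipoly_poly: "quasipoly (\<lambda>x. poly p (of_int x))"
  by (rule quasipolyI[of 1 _ "\<lambda>_. p"]) auto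

lemma quasipoly_const: "quasipoly (\<lambda>_. c)"
  using quasipoly_poly[of "[:c:]"] by simp

lemma quasipoly_of_int: "quasipoly of_int"
  using quasipoly_poly[of "[:0, 1:]"] by simp

lemma quasipoly_periodic:
  assumes "N > 0"
  shows "quasipoly (\<lambda>x. g (x mod N))"
  by (rule quasipolyI[of N _ "\<lambda>s. [:g s:]"]) (use assms in auto)

lemma quasipoly_add:
  assumes "quasipoly u" "quasipoly v"
  shows "quasipoly (\<lambda>x. u x + v x)"
proof -
  obtain N p where N: "N > 0" "\<And>x. u x = poly (p (x mod N)) (of_int x)"
    using assms(1) unfolding quasipoly_def by blast
  obtain N' p' where N': "N' > 0" "\<And>x. v x = poly (p' (x mod N')) (of_int x)"
    using assms(2) unfolding quasipoly_def by blast
  \<comment> \<open>\<open>N * N'\<close> is a common period: a residue modulo the product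
    determines the residues modulo both factors.\<close>
  show ?thesis
    by (rule quasipolyI[of "N * N'" _ "\<lambda>s. p (s mod N) + p' (s mod N')"])
      (use N N' in \<open>simp_all add: mod_mod_cancel\<close>)
qed

lemma quasipoly_mult:
  assumes "quasipoly u" "quasipoly v"
  shows "quasipoly (\<lambda>x. u x * v x)"
proof -
  obtain N p where N: "N > 0" "\<And>x. u x = poly (p (x mod N)) (of_int x)"
    using assms(1) unfolding quasipoly_def by blast
  obtain N' p' where N': "N' > 0" "\<And>x. v x = poly (p' (x mod N')) (of_int x)"
    using assms(2) unfolding quasipoly_def by blast
  show ?thesis
    by (rule quasipolyI[of "N * N'" _ "\<lambda>s. p (s mod N) * p' (s mod N')"])
      (use N N' in \<open>simp_all add: mod_mod_cancel\<close>)
qed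

section \<open>Discrete antiderivatives\<close>

lemma power_antidifference:
  "\<exists>P :: real poly. \<forall>x. poly P x - poly P (x - 1) = x ^ k"
proof (induction k rule: less_induct)
  case (less k)
  then obtain Q :: "nat \<Rightarrow> real poly"
    where Q: "\<And>j x. j < k \<Longrightarrow> poly (Q j) x - poly (Q j) (x - 1) = x ^ j"
    by metis
  \<comment> \<open>The \<open>c j\<close> are the coefficients of \<open>(x - 1) ^ Suc k\<close>
    below degree \<open>k\<close>. Solving this expansion for \<open>x ^ k\<close> and replacing
    each lower power by a difference of \<open>Q j\<close> gives \<open>P\<close>.\<close>
  define c :: "nat \<Rightarrow> real" where "c j = of_nat (Suc k choose j) * (- 1) ^ (Suc k - j)" for j
  define P where "P = smult (1 / (1 + real k)) (monom 1 (Suc k) + (\<Sum>j<k. smult (c j) (Q j)))"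
  have "poly P x - poly P (x - 1) = x ^ k" for x
  proof -
    have "(x - 1) ^ Suc k = (\<Sum>j\<le>Suc k. c j * x ^ j)"
      using binomial_ring[of x "-1" "Suc k"] by (simp add: c_def mult_ac)
    also have "\<dots> = x ^ Suc k - (1 + real k) * x ^ k + (\<Sum>j<k. c j * x ^ j)"
      by (simp add: c_def lessThan_Suc_atMost[symmetric] del: power_Suc) (simp add: algebra_simps)
    also have "(\<Sum>j<k. c j * x ^ j) = (\<Sum>j<k. c j * poly (Q j) x) - (\<Sum>j<k. c j * poly (Q j) (x - 1))"
      by (simp add: Q[symmetric] right_diff_distrib sum_subtractf)
    finally have "(1 + real k) * (poly P x - poly P (x - 1)) = (1 + real k) * x ^ k"
      by (simp add: P_def poly_sum poly_monom right_diff_distrib del: power_Suc)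
    then show ?thesis by simp
  qed
  then show ?case by blast
qed

lemma poly_antidifference:
  fixes p :: "real poly"
  shows "\<exists>P. \<forall>x. poly P x - poly P (x - 1) = poly p x"
proof -
  obtain Q :: "nat \<Rightarrow> real poly"
    where Q: "\<And>j x. poly (Q j) x - poly (Q j) (x - 1) = x ^ j"
    using power_antidifference by metis
  have "poly (\<Sum>j\<le>degree p. smult (coeff p j) (Q j)) x
      - poly (\<Sum>j\<le>degree p. smult (coeff p j) (Q j)) (x - 1) = poly p x" for x
    by (simp add: poly_sum poly_altdef[of p] right_diff_distrib[symmetric]
        sum_subtractf[symmetric] Q)
  then show ?thesis by blast
qed

text \<open>On a residue class \<open>r\<close> modulo \<open>N\<close> substitute \<open>x = N * m + r\<close>; the antidifference
  in \<open>m\<close> becomes a step function of \<open>x\<close> through \<open>m = (x - r) div N\<close>.\<close>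

lemma quasipoly_antidifference:
  assumes "quasipoly u"
  obtains U where "quasipoly U" "\<And>x. U x - U (x - 1) = u x"
proof -
  obtain N p where N: "N > 0" and u: "\<And>x. u x = poly (p (x mod N)) (of_int x)"
    using assms unfolding quasipoly_def by blast
  have "\<forall>r. \<exists>P. \<forall>m. poly P m - poly P (m - 1) = poly (p r) (of_int N * m + of_int r)"
  proof
    fix r
    show "\<exists>P. \<forall>m. poly P m - poly P (m - 1) = poly (p r) (of_int N * m + of_int r)"
      using poly_antidifference[of "pcompose (p r) [:of_int r, of_int N:]"]
      by (simp add: poly_pcompose algebra_simps)
  qed
  then obtain P where
    P: "\<And>r m. poly (P r) m - poly (P r) (m - 1) = poly (p r) (of_int N * m + of_int r)"
    by metis
  define U where "U x = (\<Sum>r\<in>{0..<N}. poly (P r) (of_int ((x - r) div N)))" for x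
  have "quasipoly U"
  proof (rule quasipolyI[OF N])
    fix x
    \<comment> \<open>On a fixed residue class modulo \<open>N\<close> the quotient is affine in
      \<open>x\<close>: its constant term depends only on \<open>r\<close> and
      \<open>x mod N\<close>.\<close>
    have "real_of_int ((x - r) div N) =
        - of_int (r + (x mod N - r) mod N) / of_int N + of_int x / of_int N" for r
    proof -
      have "N * ((x - r) div N) + (x - r) mod N = x - r" by simp
      then have "real_of_int N * of_int ((x - r) div N) + of_int ((x - r) mod N) = of_int x - of_int r"
        by (metis of_int_add of_int_diff of_int_mult)
      then show ?thesis using N by (simp add: mod_diff_left_eq field_simps)
    qed
    then show "U x = poly ((\<lambda>s. \<Sum>r\<in>{0..<N}.
        pcompose (P r) [:- of_int (r + (s - r) mod N) / of_int N, 1 / of_int N:]) (x mod N))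
            (of_int x)"
      by (simp add: U_def poly_sum poly_pcompose)
  qed
  moreover have "U x - U (x - 1) = u x" for x
  proof -
    \<comment> \<open>Passing from \<open>x - 1\<close> to \<open>x\<close> changes the quotient
      \<open>(x - r) div N\<close> for exactly one \<open>r\<close>, the residue of
      \<open>x\<close>. All other summands of \<open>U\<close> cancel.\<close>
    have "poly (P r) (of_int ((x - r) div N)) - poly (P r) (of_int ((x - 1 - r) div N)) =
        (if r = x mod N then u x else 0)" if r: "r \<in> {0..<N}" for r
    proof (cases "r = x mod N")
      case True
      define m where "m = x div N"
      have x: "x = N * m + r" using True by (simp add: m_def)
      have "(x - r) div N = m" using N x by simp
      \<comment> \<open>The witness \<open>N - 1\<close> is the remainder, since
        \<open>x - 1 - r = N * (m - 1) + (N - 1)\<close>.\<close>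
      moreover have "(x - 1 - r) div N = m - 1"
        using N by (intro int_div_pos_eq[of _ _ _ "N - 1"]) (auto simp: x algebra_simps)
      moreover have "real_of_int x = of_int N * of_int m + of_int r"
        by (subst x) simp
      then have "u x = poly (p r) (of_int N * of_int m + of_int r)"
        by (simp only: u True[symmetric])
      ultimately show ?thesis using True P[of r "of_int m"] by simp
    next
      case False
      define m s where "m = (x - r) div N" and "s = (x - r) mod N"
      have x: "x - r = N * m + s" by (simp add: m_def s_def)
      have "s \<noteq> 0"
      proof
        assume "s = 0"
        then have "x = r + N * m" using x by simp
        then have "x mod N = r" using r by simp
        then show False using False by simp
      qed
      moreover have "0 \<le> s" "s < N" using N by (simp_all add: s_def)
      ultimately have "(x - 1 - r) div N = m"
        using x by (intro int_div_pos_eq[of _ _ _ "s - 1"]) auto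
      then show ?thesis using False by (simp add: m_def)
    qed
    then have "U x - U (x - 1) = (\<Sum>r\<in>{0..<N}. if r = x mod N then u x else 0)"
      unfolding U_def sum_subtractf[symmetric] by (intro sum.cong) auto
    then show ?thesis using N by simp
  qed
  ultimately show thesis using that by blast
qed

text \<open>Telescoping gives \<open>U (b - 1) - U a\<close>. The term \<open>U (b - 1)\<close> is
  written as \<open>U b - u b\<close> because \<open>b\<close> will be a homogeneous linear form and
  \<open>b - 1\<close> is not one. For \<open>b \<le> a\<close> the sum is empty but the right side
  need not vanish.\<close>

lemma sum_antidifference:
  fixes U :: "int \<Rightarrow> real"
  assumes "\<And>x. U x - U (x - 1) = u x" and "a < b"
  shows "(\<Sum>x\<in>{a<..<b}. u x) = U b - u b - U a"
  using assms(2)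
proof (induction b rule: int_gr_induct)
  case base
  have "{a<..<a + 1} = {}" by auto
  then show ?case using assms(1)[of "a + 1"] by simp
next
  case (step b)
  have "{a<..<b + 1} = insert b {a<..<b}" using step by auto
  then show ?case using step assms(1)[of "b + 1"] by simp
qed

subsection \<open>Piecewise quasipolynomials in several variables\<close>

definition linform :: "nat \<Rightarrow> ((nat \<Rightarrow> int) \<Rightarrow> int) \<Rightarrow> bool" where
  "linform n l \<longleftrightarrow> (\<exists>c. \<forall>y. l y = (\<Sum>i<n. c i * y i))"

lemma linform_var:
  assumes "i < n"
  shows "linform n (\<lambda>y. y i)"
proof -
  have "(\<Sum>j<n. (if j = i then 1 else 0) * y j) = y i" for y :: "nat \<Rightarrow> int"
    using assms by (simp add: if_distrib[of "\<lambda>c. c * _"] cong: if_cong)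
  then show ?thesis unfolding linform_def by metis
qed

lemma linform_scale:
  assumes "linform n l"
  shows "linform n (\<lambda>y. a * l y)"
proof -
  obtain c where "\<And>y. l y = (\<Sum>i<n. c i * y i)" using assms unfolding linform_def by blast
  then have "\<forall>y. a * l y = (\<Sum>i<n. (a * c i) * y i)" by (simp add: sum_distrib_left mult.assoc)
  then show ?thesis unfolding linform_def by (rule exI[of _ "\<lambda>i. a * c i"])
qed

lemma linform_add:
  assumes "linform n l" "linform n k"
  shows "linform n (\<lambda>y. l y + k y)"
proof -
  obtain c where "\<And>y. l y = (\<Sum>i<n. c i * y i)" using assms unfolding linform_def by blast
  moreover obtain d where "\<And>y. k y = (\<Sum>i<n. d i * y i)" using assms unfolding linform_def by blast
  ultimately have "\<forall>y. l y + k y = (\<Sum>i<n. (c i + d i) * y i)"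
    by (simp add: sum.distrib distrib_right)
  then show ?thesis unfolding linform_def by (rule exI[of _ "\<lambda>i. c i + d i"])
qed

lemma linform_uminus: "linform n l \<Longrightarrow> linform n (\<lambda>y. - l y)"
  using linform_scale[of n l "-1"] by simp

lemma linform_diff: "linform n l \<Longrightarrow> linform n k \<Longrightarrow> linform n (\<lambda>y. l y - k y)"
  using linform_add[OF _ linform_uminus, of n l k] by simp

text \<open>Splits off the coefficient of the last variable, the one about to be summed out; the
  rest is again homogeneous and does not involve that variable.\<close>

lemma linform_SucE:
  assumes "linform (Suc n) l"
  obtains a l' where "linform n l'" "\<And>y x. l (y(n := x)) = a * x + l' y"
proof -
  obtain c where c: "\<And>y. l y = (\<Sum>i<Suc n. c i * y i)" using assms unfolding linform_def by blast
  show thesis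
    by (rule that[of "\<lambda>y. \<Sum>i<n. c i * y i" "c n"]) (auto simp: linform_def c)
qed

text \<open>The variables are \<open>y 0, \<dots>, y (n - 1)\<close>, and \<open>y 0\<close> plays the role of the dilation factor.
  Constant terms are deliberately absent from the linear forms in the indicators.\<close>

inductive pw_quasipoly :: "nat \<Rightarrow> ((nat \<Rightarrow> int) \<Rightarrow> real) \<Rightarrow> bool" for n where
  pw_quasipoly_const: "pw_quasipoly n (\<lambda>_. c)"
| pw_quasipoly_lin: "linform n l \<Longrightarrow> pw_quasipoly n (\<lambda>y. of_int (l y))"
| pw_quasipoly_periodic: "linform n l \<Longrightarrow> N > 0 \<Longrightarrow> pw_quasipoly n (\<lambda>y. g (l y mod N))"
| pw_quasipoly_pos: "linform n l \<Longrightarrow> pw_quasipoly n (\<lambda>y. of_bool (0 < l y))"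
| pw_quasipoly_add: "pw_quasipoly n f \<Longrightarrow> pw_quasipoly n g \<Longrightarrow> pw_quasipoly n (\<lambda>y. f y + g y)"
| pw_quasipoly_mult: "pw_quasipoly n f \<Longrightarrow> pw_quasipoly n g \<Longrightarrow> pw_quasipoly n (\<lambda>y. f y * g y)"

lemma pw_quasipoly_uminus: "pw_quasipoly n f \<Longrightarrow> pw_quasipoly n (\<lambda>y. - f y)"
  using pw_quasipoly_mult[OF pw_quasipoly_const[of n "-1"], of f] by simp

lemma pw_quasipoly_diff: "pw_quasipoly n f \<Longrightarrow> pw_quasipoly n g \<Longrightarrow> pw_quasipoly n (\<lambda>y. f y - g y)"
  using pw_quasipoly_add[OF _ pw_quasipoly_uminus, of n f g] by simp

lemma pw_quasipoly_sum:
  assumes "\<And>i. i \<in> I \<Longrightarrow> pw_quasipoly n (f i)"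
  shows "pw_quasipoly n (\<lambda>y. \<Sum>i\<in>I. f i y)"
  using assms
proof (induction I rule: infinite_finite_induct)
  case (insert i I)
  then have "pw_quasipoly n (\<lambda>y. f i y + (\<Sum>i\<in>I. f i y))" by (intro pw_quasipoly_add) auto
  then show ?case using insert by simp
qed (simp_all add: pw_quasipoly_const)

lemma pw_quasipoly_power: "pw_quasipoly n f \<Longrightarrow> pw_quasipoly n (\<lambda>y. f y ^ k)"
  by (induction k) (auto intro: pw_quasipoly_const pw_quasipoly_mult)

lemma pw_quasipoly_poly: "pw_quasipoly n f \<Longrightarrow> pw_quasipoly n (\<lambda>y. poly p (f y))"
  unfolding poly_altdef
    by (intro pw_quasipoly_sum pw_quasipoly_mult pw_quasipoly_power pw_quasipoly_const)

lemma pw_quasipoly_not: "pw_quasipoly n (\<lambda>y. of_bool (P y)) \<Longrightarrow> pw_quasipoly n (\<lambda>y. of_bool (\<not> P y))"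
  using pw_quasipoly_diff[OF pw_quasipoly_const[of n 1], of "\<lambda>y. of_bool (P y)"]
    by (simp add: of_bool_not_iff)

lemma pw_quasipoly_conj:
  "pw_quasipoly n (\<lambda>y. of_bool (P y)) \<Longrightarrow> pw_quasipoly n (\<lambda>y. of_bool (Q y)) \<Longrightarrow>
    pw_quasipoly n (\<lambda>y. of_bool (P y \<and> Q y))"
  using pw_quasipoly_mult[of n "\<lambda>y. of_bool (P y)" "\<lambda>y. of_bool (Q y)"] by (simp add: of_bool_conj)

lemma pw_quasipoly_ball:
  assumes "finite I" "\<And>i. i \<in> I \<Longrightarrow> pw_quasipoly n (\<lambda>y. of_bool (P i y))"
  shows "pw_quasipoly n (\<lambda>y. of_bool (\<forall>i\<in>I. P i y))"
  using assms
proof (induction I)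
  case (insert i I)
  then have "pw_quasipoly n (\<lambda>y. of_bool (P i y \<and> (\<forall>i\<in>I. P i y)))" by (intro pw_quasipoly_conj) auto
  then show ?case by simp
qed (use pw_quasipoly_const[of n 1] in simp)

lemma pw_quasipoly_less:
  "linform n l \<Longrightarrow> linform n k \<Longrightarrow> pw_quasipoly n (\<lambda>y. of_bool (l y < k y))"
  using pw_quasipoly_pos[OF linform_diff, of n k l] by simp

lemma pw_quasipoly_le:
  "linform n l \<Longrightarrow> linform n k \<Longrightarrow> pw_quasipoly n (\<lambda>y. of_bool (l y \<le> k y))"
  using pw_quasipoly_not[OF pw_quasipoly_less, of n k l] by (simp add: not_less)

lemma pw_quasipoly_eq:
  assumes "linform n l" "linform n k"
  shows "pw_quasipoly n (\<lambda>y. of_bool (l y = k y))"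
  using pw_quasipoly_conj[OF pw_quasipoly_le[OF assms] pw_quasipoly_le[OF assms(2,1)]]
    by (simp add: order_eq_iff)

text \<open>Quotients \<open>l y div a\<close> arise as integer end points of summation ranges. The
  residue \<open>s\<close> of \<open>l y\<close> modulo \<open>a * N\<close> determines both
  \<open>l y mod a\<close>, which makes the quotient affine in \<open>l y\<close>, and the quotient
  modulo \<open>N\<close>, which selects the polynomial. A finite sum over \<open>s\<close> of
  indicators times polynomials therefore represents the function.\<close>

lemma pw_quasipoly_compose_div:
  assumes "quasipoly u" "linform n l" "a > 0"
  shows "pw_quasipoly n (\<lambda>y. u (l y div a))"
proof -
  obtain N p where N: "N > 0" and u: "\<And>x. u x = poly (p (x mod N)) (of_int x)"
    using assms(1) unfolding quasipoly_def by blast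
  let ?S = "{0..<a * N}"
  have expand: "u (l y div a) = (\<Sum>s\<in>?S. of_bool (l y mod (a * N) = s) *
      poly (p (s div a)) ((of_int (l y) - of_int (s mod a)) * (1 / of_int a)))" for y
  proof -
    define s where "s = l y mod (a * N)"
    have s: "s \<in> ?S" using N assms(3) by (simp add: s_def)
    have "s mod a = l y mod a" by (simp add: s_def mod_mod_cancel)
    then have "real_of_int (l y div a) = (of_int (l y) - of_int (s mod a)) * (1 / of_int a)"
      using assms(3) by (simp add: field_simps flip: of_int_mult of_int_add)
    moreover have "(l y div a) mod N = s div a"
    proof -
      have "s = a * (l y div a mod N) + l y mod a"
        using assms(3) by (simp add: s_def mod_mult2_eq' zmod_zmult2_eq N less_imp_le)
      then show ?thesis using assms(3) by simp
    qed
    ultimately have "u (l y div a) =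
        poly (p (s div a)) ((of_int (l y) - of_int (s mod a)) * (1 / of_int a))"
      by (simp add: u)
    also have "\<dots> = (\<Sum>s'\<in>?S. if s' = s then
        poly (p (s' div a)) ((of_int (l y) - of_int (s' mod a)) * (1 / of_int a)) else 0)"
      using s by simp
    also have "\<dots> = (\<Sum>s'\<in>?S. of_bool (s = s') *
        poly (p (s' div a)) ((of_int (l y) - of_int (s' mod a)) * (1 / of_int a)))"
      by (intro sum.cong) auto
    finally show ?thesis by (simp only: s_def)
  qed
  have "pw_quasipoly n (\<lambda>y. of_bool (l y mod (a * N) = s))" for s
    by (rule pw_quasipoly_periodic[of n l "a * N" "\<lambda>r. of_bool (r = s)"]) (use assms N in auto)
  then show ?thesis
    unfolding expand
      by (intro pw_quasipoly_sum pw_quasipoly_mult pw_quasipoly_poly pw_quasipoly_diff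
          pw_quasipoly_lin pw_quasipoly_const assms)
qed

lemma pw_quasipoly_compose: "quasipoly u \<Longrightarrow> linform n l \<Longrightarrow> pw_quasipoly n (\<lambda>y. u (l y))"
  using pw_quasipoly_compose_div[of u n l 1] by simp

text \<open>As a function of the last variable \<open>x\<close>, a product of lower bounds \<open>l y < a * x\<close>
  equals the largest of them; which one is largest depends on \<open>y\<close> only. An upper bound is the
  complement of a lower bound and an equation, so one bound per summand suffices.\<close>

inductive slice_bound :: "nat \<Rightarrow> ((nat \<Rightarrow> int) \<Rightarrow> int \<Rightarrow> real) \<Rightarrow> bool" for n where
  slice_bound_none: "slice_bound n (\<lambda>_ _. 1)"
| slice_bound_less: "a > 0 \<Longrightarrow> linform n l \<Longrightarrow> slice_bound n (\<lambda>y x. of_bool (l y < a * x))"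
| slice_bound_eq: "a > 0 \<Longrightarrow> linform n l \<Longrightarrow> slice_bound n (\<lambda>y x. of_bool (a * x = l y))"

text \<open>In each summand \<open>y\<close> and the summation variable \<open>x\<close> are
  separated except in a single bound, so that summing over \<open>x\<close> only requires an
  antidifference of \<open>u\<close> evaluated at the ends of the range.\<close>

inductive sliced :: "nat \<Rightarrow> ((nat \<Rightarrow> int) \<Rightarrow> int \<Rightarrow> real) \<Rightarrow> bool" for n where
  sliced_basic: "pw_quasipoly n c \<Longrightarrow> quasipoly u \<Longrightarrow> slice_bound n I \<Longrightarrow>
    sliced n (\<lambda>y x. c y * u x * I y x)"
| sliced_add: "sliced n F \<Longrightarrow> sliced n G \<Longrightarrow> sliced n (\<lambda>y x. F y x + G y x)"

section \<open>Algebra of sliced functions\<close>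

lemma sliced_scale:
  assumes "sliced n F" "pw_quasipoly n c" "quasipoly u"
  shows "sliced n (\<lambda>y x. c y * u x * F y x)"
  using assms
proof induction
  case (sliced_basic d v I)
  then have "sliced n (\<lambda>y x. (c y * d y) * (u x * v x) * I y x)"
    by (intro sliced.sliced_basic pw_quasipoly_mult quasipoly_mult)
  then show ?case by (simp add: mult_ac)
next
  case (sliced_add F G)
  then have "sliced n (\<lambda>y x. c y * u x * F y x + c y * u x * G y x)"
    by (intro sliced.sliced_add) auto
  then show ?case by (simp add: distrib_left)
qed

lemma sliced_sep: "pw_quasipoly n c \<Longrightarrow> quasipoly u \<Longrightarrow> sliced n (\<lambda>y x. c y * u x)"
  using sliced_basic[OF _ _ slice_bound_none, of n c u] by simp

lemma sliced_coeff: "pw_quasipoly n c \<Longrightarrow> sliced n (\<lambda>y x. c y)"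
  using sliced_sep[OF _ quasipoly_const[of 1], of n c] by simp

lemma sliced_bound: "pw_quasipoly n c \<Longrightarrow> slice_bound n I \<Longrightarrow> sliced n (\<lambda>y x. c y * I y x)"
  using sliced_basic[OF _ quasipoly_const[of 1], of n c I] by simp

lemma sliced_less: "a > 0 \<Longrightarrow> linform n l \<Longrightarrow> sliced n (\<lambda>y x. of_bool (l y < a * x))"
  using sliced_bound[OF pw_quasipoly_const[of n 1] slice_bound_less] by simp

lemma sliced_eq: "a > 0 \<Longrightarrow> linform n l \<Longrightarrow> sliced n (\<lambda>y x. of_bool (a * x = l y))"
  using sliced_bound[OF pw_quasipoly_const[of n 1] slice_bound_eq] by simp

lemma sliced_sum:
  assumes "\<And>i. i \<in> I \<Longrightarrow> sliced n (F i)"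
  shows "sliced n (\<lambda>y x. \<Sum>i\<in>I. F i y x)"
  using assms
proof (induction I rule: infinite_finite_induct)
  case (insert i I)
  then have "sliced n (\<lambda>y x. F i y x + (\<Sum>i\<in>I. F i y x))" by (intro sliced_add) auto
  then show ?case using insert by simp
qed (simp_all add: sliced_coeff[OF pw_quasipoly_const])

text \<open>The equation determines \<open>x\<close>, so the inequality, multiplied by the positive
  number \<open>a\<close>, becomes a condition on \<open>l\<close> and \<open>m\<close>
  alone.\<close>

lemma eq_less_mult:
  fixes a b x l m :: int
  assumes "a > 0" "b > 0"
  shows "of_bool (a * x = l) * of_bool (m < b * x) = of_bool (a * m < b * l) * (of_bool (a * x = l) :: real)"
proof -
  have "m < b * x \<longleftrightarrow> a * m < b * l" if "a * x = l"
    using assms that by (auto simp: mult.left_commute[of b a] simp flip: that)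
  then show ?thesis by auto
qed

text \<open>This keeps the number of bounds per summand at one. Of two inequalities the stronger
  survives; an equation absorbs any other bound, which it turns into a condition free of
  \<open>x\<close>.\<close>

lemma sliced_bound_mult:
  assumes "slice_bound n I" "slice_bound n J"
  shows "sliced n (\<lambda>y x. I y x * J y x)"
proof -
  have eq_less: "sliced n (\<lambda>y x. of_bool (a * x = l y) * of_bool (m y < b * x))"
    if "a > 0" "b > 0" "linform n l" "linform n m" for a b l m
    using that sliced_bound[OF pw_quasipoly_less[OF linform_scale[of n m a] linform_scale[of n
        l b]] slice_bound_eq[of a n l]]
    by (simp add: eq_less_mult)
  show ?thesis
    using assms(1)
  proof cases
    case slice_bound_none
    then show ?thesis using sliced_bound[OF pw_quasipoly_const[of n 1] assms(2)] by simp
  next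
    case less: (slice_bound_less a l)
    show ?thesis
      using assms(2)
    proof cases
      case slice_bound_none
      then show ?thesis using sliced_bound[OF pw_quasipoly_const[of n 1] assms(1)] by simp
    next
      case (slice_bound_less b m)
      \<comment> \<open>The thresholds \<open>l y / a\<close> and \<open>m y / b\<close> are
        compared after cross-multiplication. A tie is assigned to the first summand, so the two
        cases are disjoint.\<close>
      have "of_bool (l y < a * x) * of_bool (m y < b * x) =
          of_bool (a * m y \<le> b * l y) * of_bool (l y < a * x) +
          of_bool (b * l y < a * m y) * (of_bool (m y < b * x) :: real)" for y x
      proof -
        have "m y < b * x" if "a * m y \<le> b * l y" "l y < a * x"
        proof -
          have "a * m y < b * (a * x)"
            using that slice_bound_less(2) by (smt (verit) mult_less_cancel_left_pos)
          then show ?thesis using less(2) by (simp add: mult.left_commute[of b a])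
        qed
        moreover have "l y < a * x" if "b * l y < a * m y" "m y < b * x"
        proof -
          have "b * l y < a * (b * x)"
            using that less(2) by (smt (verit) mult_less_cancel_left_pos)
          then show ?thesis using slice_bound_less(2) by (simp add: mult.left_commute[of a b])
        qed
        moreover have "a * m y \<le> b * l y \<longleftrightarrow> \<not> b * l y < a * m y" by linarith
        ultimately show ?thesis by auto
      qed
      then show ?thesis
        using less slice_bound_less
        by (auto intro!: sliced_add sliced_bound pw_quasipoly_le pw_quasipoly_less
            linform_scale slice_bound.slice_bound_less)
    next
      case (slice_bound_eq b m)
      then show ?thesis using less eq_less[of b a m l] by (simp add: mult.commute)
    qed
  next
    case eq: (slice_bound_eq a l)
    show ?thesis
      using assms(2)
    proof cases
      case slice_bound_none
      then show ?thesis using sliced_bound[OF pw_quasipoly_const[of n 1] assms(1)] by simp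
    next
      case (slice_bound_less b m)
      then show ?thesis using eq eq_less[of a b l m] by simp
    next
      case (slice_bound_eq b m)
      have eq_eq: "of_bool (a * x = l y) * of_bool (b * x = m y) =
          of_bool (b * l y = a * m y) * (of_bool (a * x = l y) :: real)" for y x
      proof -
        have "b * x = m y \<longleftrightarrow> b * l y = a * m y" if "a * x = l y"
          using eq(2) by (auto simp: mult.left_commute[of b a] simp flip: that)
        then show ?thesis by auto
      qed
      show ?thesis
        unfolding eq(1) slice_bound_eq(1) eq_eq
        by (intro sliced_bound pw_quasipoly_eq linform_scale slice_bound.slice_bound_eq eq
            slice_bound_eq)
    qed
  qed
qed

lemma sliced_mult:
  assumes "sliced n F" "sliced n G"
  shows "sliced n (\<lambda>y x. F y x * G y x)"
  using assms(1)
proof induction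
  case F: (sliced_basic c u I)
  show ?case
    using assms(2)
  proof induction
    case (sliced_basic d v J)
    have "sliced n (\<lambda>y x. (c y * d y) * (u x * v x) * (I y x * J y x))"
      using F sliced_basic
        by (intro sliced_scale sliced_bound_mult pw_quasipoly_mult quasipoly_mult)
    then show ?case by (simp add: mult_ac)
  next
    case (sliced_add F' G')
    then show ?case using sliced.sliced_add by (simp add: distrib_left)
  qed
next
  case (sliced_add F' G')
  then show ?case using sliced.sliced_add by (simp add: distrib_right)
qed

lemma sliced_of_pw_quasipoly:
  assumes "pw_quasipoly (Suc n) f"
  shows "sliced n (\<lambda>y x. f (y(n := x)))"
  using assms
proof induction
  case (pw_quasipoly_const c)
  then show ?case by (intro sliced_coeff pw_quasipoly.pw_quasipoly_const)
next
  case (pw_quasipoly_lin l)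
  then obtain a l' where l: "linform n l'" "\<And>y x. l (y(n := x)) = a * x + l' y"
    by (rule linform_SucE) blast
  have "sliced n (\<lambda>y x. of_int a * of_int x + of_int (l' y))"
    by (intro sliced_add sliced_sep sliced_coeff pw_quasipoly.pw_quasipoly_const
        pw_quasipoly.pw_quasipoly_lin quasipoly_of_int l)
  then show ?case by (simp only: l of_int_add of_int_mult)
next
  case (pw_quasipoly_periodic l N g)
  then obtain a l' where l: "linform n l'" "\<And>y x. l (y(n := x)) = a * x + l' y"
    by (elim linform_SucE) blast
  \<comment> \<open>Splitting by the residue \<open>r\<close> of \<open>x\<close> separates
    \<open>x\<close> from \<open>y\<close> inside \<open>g\<close>.\<close>
  have "sliced n (\<lambda>y x. \<Sum>r\<in>{0..<N}. g ((a * r + l' y mod N) mod N) * of_bool (x mod N = r))"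
    using pw_quasipoly_periodic
    by (intro sliced_sum sliced_sep quasipoly_periodic[of N "\<lambda>s. of_bool (s = _)"] l
        pw_quasipoly.pw_quasipoly_periodic[of n l' N "\<lambda>s. g ((a * _ + s) mod N)"])
  moreover have "(\<Sum>r\<in>{0..<N}. g ((a * r + l' y mod N) mod N) * of_bool (x mod N = r))
      = g ((a * x + l' y) mod N)" for x y
  proof -
    have "(\<Sum>r\<in>{0..<N}. g ((a * r + l' y mod N) mod N) * of_bool (x mod N = r))
        = (\<Sum>r\<in>{0..<N}. if r = x mod N then g ((a * r + l' y mod N) mod N) else 0)"
      by (intro sum.cong) auto
    also have "\<dots> = g ((a * (x mod N) + l' y mod N) mod N)"
      using pw_quasipoly_periodic by simp
    also have "(a * (x mod N) + l' y mod N) mod N = (a * x + l' y) mod N"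
      by (metis mod_add_left_eq mod_add_right_eq mod_mult_right_eq)
    finally show ?thesis .
  qed
  ultimately show ?case by (simp only: l)
next
  case (pw_quasipoly_pos l)
  then obtain a l' where l: "linform n l'" "\<And>y x. l (y(n := x)) = a * x + l' y"
    by (rule linform_SucE) blast
  consider "a > 0" | "a = 0" | "a < 0" by linarith
  then show ?case
  proof cases
    case 1
    then have "sliced n (\<lambda>y x. of_bool (- l' y < a * x))" by (intro sliced_less linform_uminus l)
    moreover have "- l' y < a * x \<longleftrightarrow> 0 < a * x + l' y" for x y by linarith
    ultimately show ?thesis by (simp only: l)
  next
    case 2
    then show ?thesis using sliced_coeff[OF pw_quasipoly.pw_quasipoly_pos[OF l(1)]]
      by (simp only: l mult_zero_left add_0)
  next
    case 3
    \<comment> \<open>For \<open>a < 0\<close> the condition is the upper bound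
      \<open>(- a) * x < l' y\<close>, expressed as one minus the opposite strict bound minus the
      case of equality.\<close>
    have "sliced n (\<lambda>y x. 1 + (- 1) * 1 * of_bool (l' y < (- a) * x) + (- 1) * 1 * of_bool ((- a) * x = l' y))"
      using 3 l
        by (intro sliced_add sliced_coeff sliced_scale sliced_less sliced_eq
            pw_quasipoly.pw_quasipoly_const quasipoly_const) auto
    moreover have "1 + (- 1) * 1 * of_bool (l' y < (- a) * x) + (- 1) * 1 * of_bool ((- a) * x = l' y)
        = (of_bool (0 < a * x + l' y) :: real)" for x y
      by auto
    ultimately show ?thesis by (simp only: l)
  qed
qed (auto intro: sliced_add sliced_mult)

section \<open>Summation over one variable\<close>

lemma less_mult_iff_div_less:
  fixes a x l :: int
  assumes "a > 0"
  shows "l < a * x \<longleftrightarrow> l div a < x"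
proof
  assume less: "l < a * x"
  show "l div a < x"
  proof (rule ccontr)
    assume "\<not> l div a < x"
    then have "a * x \<le> a * (l div a)" using assms by simp
    then show False
      using less assms mult_div_mod_eq[of a l] pos_mod_sign[of a l] by linarith
  qed
next
  assume "l div a < x"
  then have "a * (l div a + 1) \<le> a * x" using assms by (intro mult_left_mono) auto
  then show "l < a * x"
    using assms mult_div_mod_eq[of a l] pos_mod_bound[of a l] unfolding distrib_left by linarith
qed

text \<open>A bound cuts the range down to an interval or a point whose ends are linear forms or
  their integer quotients, where the antidifference can be evaluated. The hypothesis
  \<open>n > 0\<close> ensures that \<open>y 0\<close>, which fixes the range, is among the
  remaining variables.\<close>

lemma pw_quasipoly_sum_sliced:
  assumes "sliced n F" "n > 0"
  shows "pw_quasipoly n (\<lambda>y. \<Sum>x\<in>{- (K * y 0)<..<K * y 0}. F y x)"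
  using assms(1)
proof induction
  case (sliced_basic c u I)
  obtain U where U: "quasipoly U" "\<And>x. U x - U (x - 1) = u x"
    using quasipoly_antidifference[OF sliced_basic(2)] by blast
  have linK: "linform n (\<lambda>y. K * y 0)" "linform n (\<lambda>y. - (K * y 0))"
    by (intro linform_uminus linform_scale linform_var assms(2))+
  have tele: "(\<Sum>x\<in>{a<..<b}. u x) = U b - u b - U a" if "a < b" for a b
    using sum_antidifference[of U u, OF U(2) that] .
  \<comment> \<open>The indicator handles \<open>K * y 0 \<le> 0\<close>, where the range is empty
    and the telescoping formula would fail.\<close>
  define full where "full y = of_bool (0 < K * y 0) * (U (K * y 0) - u (K * y 0) - U (- (K * y 0)))"
    for y :: "nat \<Rightarrow> int"
  have full: "(\<Sum>x\<in>{- (K * y 0)<..<K * y 0}. u x) = full y" for y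
    by (cases "0 < K * y 0") (auto simp: tele full_def)
  have pw_quasipoly_full: "pw_quasipoly n full"
    unfolding full_def
      by (intro pw_quasipoly_mult pw_quasipoly_diff pw_quasipoly_pos pw_quasipoly_compose linK
          sliced_basic U)
  have "pw_quasipoly n (\<lambda>y. \<Sum>x\<in>{- (K * y 0)<..<K * y 0}. u x * I y x)"
    using sliced_basic(3)
  proof cases
    case slice_bound_none
    then show ?thesis using pw_quasipoly_full by (simp add: full)
  next
    case (slice_bound_less a l)
    \<comment> \<open>The threshold \<open>l y div a\<close> may lie below the range, which gives
      the full sum, inside it, which gives a truncated sum, or beyond it, which gives zero. The
      cases are tested on \<open>l y\<close> itself so that only linear forms are compared.\<close>
    have "(\<Sum>x\<in>{- (K * y 0)<..<K * y 0}. u x * of_bool (l y < a * x)) =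
        of_bool (l y < a * (- (K * y 0))) * full y +
        of_bool (\<not> l y < a * (- (K * y 0)) \<and> l y < a * (K * y 0)) *
          (U (K * y 0) - u (K * y 0) - U (l y div a))" for y
    proof -
      have div: "l y < a * x \<longleftrightarrow> l y div a < x" for x
        using less_mult_iff_div_less[OF slice_bound_less(2)] .
      have restrict: "(\<Sum>x\<in>{- (K * y 0)<..<K * y 0}. u x * of_bool (l y < a * x)) =
          (\<Sum>x\<in>{max (- (K * y 0)) (l y div a)<..<K * y 0}. u x)"
        unfolding div by (intro sum.mono_neutral_cong_right) auto
      consider "l y div a < - (K * y 0)" | "- (K * y 0) \<le> l y div a" "l y div a < K * y 0"
        | "- (K * y 0) \<le> l y div a" "K * y 0 \<le> l y div a" by linarith
      then show ?thesis
      proof cases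
        case 1
        then show ?thesis unfolding restrict unfolding div using full[of y] by (simp add: max_def)
      next
        case 2
        then show ?thesis unfolding restrict unfolding div using tele[of "l y div a" "K * y 0"]
          by (simp add: max_def)
      next
        case 3
        then show ?thesis unfolding restrict unfolding div by (simp add: max_def)
      qed
    qed
    then show ?thesis
      unfolding slice_bound_less(1)
      by (simp only:) (intro pw_quasipoly_add pw_quasipoly_mult pw_quasipoly_full
          pw_quasipoly_diff[OF pw_quasipoly_diff[OF pw_quasipoly_compose pw_quasipoly_compose]
              pw_quasipoly_compose_div]
          pw_quasipoly_conj pw_quasipoly_not pw_quasipoly_less linform_scale linK U
              sliced_basic slice_bound_less)
  next
    case (slice_bound_eq a l)
    \<comment> \<open>The equation selects at most one \<open>x\<close>, namely
      \<open>l y div a\<close>, and does so only if \<open>a\<close> divides \<open>l y\<close> and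
      this quotient lies in the range.\<close>
    have "(\<Sum>x\<in>{- (K * y 0)<..<K * y 0}. u x * of_bool (a * x = l y)) =
        of_bool (a * (- (K * y 0)) < l y \<and> l y < a * (K * y 0)) * of_bool (l y mod a = 0) *
          u (l y div a)" for y
    proof (cases "l y mod a = 0")
      case True
      then obtain z where z: "l y = a * z" by (auto simp: mod_eq_0_iff_dvd)
      then have "(\<Sum>x\<in>{- (K * y 0)<..<K * y 0}. u x * of_bool (a * x = l y)) =
          (\<Sum>x\<in>{- (K * y 0)<..<K * y 0}. if x = z then u x else 0)"
        using slice_bound_eq(2) by (intro sum.cong) auto
      also have "\<dots> = of_bool (- (K * y 0) < z \<and> z < K * y 0) * u z"
        by simp
      finally show ?thesis using z slice_bound_eq(2) by (simp del: mult_minus_right)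
    next
      case False
      then have "a * x \<noteq> l y" for x by (metis mod_mult_self1_is_0)
      then show ?thesis using False by simp
    qed
    moreover have "pw_quasipoly n (\<lambda>y. of_bool (l y mod a = 0))"
      using pw_quasipoly_periodic[of n l a "\<lambda>r. of_bool (r = 0)"] slice_bound_eq by simp
    ultimately show ?thesis
      unfolding slice_bound_eq(1)
      by (simp only:) (intro pw_quasipoly_mult pw_quasipoly_conj pw_quasipoly_less
          pw_quasipoly_compose_div linform_scale linK sliced_basic slice_bound_eq)
  qed
  then have "pw_quasipoly n (\<lambda>y. c y * (\<Sum>x\<in>{- (K * y 0)<..<K * y 0}. u x * I y x))"
    using sliced_basic by (intro pw_quasipoly_mult)
  then show ?case by (simp add: sum_distrib_left mult.assoc)
next
  case (sliced_add F G)
  then show ?case using pw_quasipoly_add by (simp add: sum.distrib)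
qed

lemma pw_quasipoly_sum_var:
  assumes "pw_quasipoly (Suc n) f" "n > 0"
  shows "pw_quasipoly n (\<lambda>y. \<Sum>x\<in>{- (K * y 0)<..<K * y 0}. f (y(n := x)))"
  using pw_quasipoly_sum_sliced[OF sliced_of_pw_quasipoly] assms by blast

section \<open>Reduction to the dilation factor alone\<close>

lemma pw_quasipoly_1_imp_quasipoly:
  assumes "pw_quasipoly 1 f"
  shows "\<exists>u. quasipoly u \<and> (\<forall>y. y 0 > 0 \<longrightarrow> f y = u (y 0))"
  using assms
proof induction
  case (pw_quasipoly_const c)
  then show ?case using quasipoly_const by blast
next
  case (pw_quasipoly_lin l)
  then obtain c where "\<And>y. l y = c * y 0" by (auto simp: linform_def)
  then show ?case
    by (intro exI[of _ "\<lambda>x. of_int c * of_int x"]) (auto intro: quasipoly_mult quasipoly_const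
        quasipoly_of_int)
next
  case (pw_quasipoly_periodic l N g)
  then obtain c where "\<And>y. l y = c * y 0" by (auto simp: linform_def)
  then show ?case
    using quasipoly_periodic[OF pw_quasipoly_periodic(2), of "\<lambda>s. g ((c * s) mod N)"]
    by (intro exI[of _ "\<lambda>x. g ((c * (x mod N)) mod N)"]) (auto simp: mod_simps)
next
  case (pw_quasipoly_pos l)
  then obtain c where "\<And>y. l y = c * y 0" by (auto simp: linform_def)
  \<comment> \<open>For \<open>y 0 > 0\<close> the sign of \<open>c * y 0\<close> is that of
    \<open>c\<close>, so the indicator is a constant. Homogeneity is what excludes exceptional small
    values here.\<close>
  then show ?case
    by (intro exI[of _ "\<lambda>x. of_bool (0 < c)"]) (auto intro: quasipoly_const
        simp: zero_less_mult_iff)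
next
  case (pw_quasipoly_add f g)
  then obtain u v where "quasipoly u" "quasipoly v"
    "\<And>y. y 0 > 0 \<Longrightarrow> f y = u (y 0)" "\<And>y. y 0 > 0 \<Longrightarrow> g y = v (y 0)" by blast
  then show ?case by (intro exI[of _ "\<lambda>x. u x + v x"]) (auto intro: quasipoly_add)
next
  case (pw_quasipoly_mult f g)
  then obtain u v where "quasipoly u" "quasipoly v"
    "\<And>y. y 0 > 0 \<Longrightarrow> f y = u (y 0)" "\<And>y. y 0 > 0 \<Longrightarrow> g y = v (y 0)" by blast
  then show ?case by (intro exI[of _ "\<lambda>x. u x * v x"]) (auto intro: quasipoly_mult)
qed

subsection \<open>Rational polygons\<close>

lemma Rats_common_denominator:
  fixes r s t :: real
  assumes "r \<in> \<rat>" "s \<in> \<rat>" "t \<in> \<rat>"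
  obtains N a b c :: int
  where "N > 0" "of_int N * r = of_int a" "of_int N * s = of_int b" "of_int N * t = of_int c"
proof -
  obtain p p' where p: "p' > 0" "r = of_int p / of_int p'" using assms(1)
    by (rule Rats_cases') blast
  obtain q q' where q: "q' > 0" "s = of_int q / of_int q'" using assms(2)
    by (rule Rats_cases') blast
  obtain k k' where k: "k' > 0" "t = of_int k / of_int k'" using assms(3)
    by (rule Rats_cases') blast
  show thesis
    by (rule that[of "p' * q' * k'" "p * q' * k'" "q * p' * k'" "k * p' * q'"])
      (use p q k in \<open>auto simp: field_simps\<close>)
qed

text \<open>A line through two distinct rational points has a rational normal vector, of which
  \<alpha> is a real multiple. Dividing by the absolute value of the factor and clearing
  denominators preserves the direction of the inequality.\<close>

lemma rational_halfplane:
  fixes \<alpha> u v :: "real \<times> real"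
  assumes "\<alpha> \<noteq> 0" "u \<noteq> v" "\<alpha> \<bullet> u = \<beta>" "\<alpha> \<bullet> v = \<beta>"
    and rat: "fst u \<in> \<rat>" "snd u \<in> \<rat>" "fst v \<in> \<rat>" "snd v \<in> \<rat>"
  obtains a b c :: int where "\<And>x. \<alpha> \<bullet> x < \<beta> \<longleftrightarrow> of_int a * fst x + of_int b * snd x < of_int c"
proof -
  define d1 d2 where "d1 = fst v - fst u" and "d2 = snd v - snd u"
  have d: "d1 \<noteq> 0 \<or> d2 \<noteq> 0" using assms(2) by (auto simp: d1_def d2_def prod_eq_iff)
  have orth: "fst \<alpha> * d1 + snd \<alpha> * d2 = 0"
    using assms(3,4) by (simp add: inner_prod_def d1_def d2_def algebra_simps)
  obtain \<mu> where \<mu>: "fst \<alpha> = \<mu> * d2" "snd \<alpha> = - \<mu> * d1"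
  proof (cases "d1 = 0")
    case True
    then show thesis using that[of "fst \<alpha> / d2"] d orth by simp
  next
    case False
    then show thesis using that[of "- snd \<alpha> / d1"] orth by (simp add: field_simps)
  qed
  \<comment> \<open>The sign of \<mu> goes into the rational normal \<open>(e1, e2)\<close>, so that
    the possibly irrational factor left over is positive and can be cancelled.\<close>
  define e1 e2 where "e1 = sgn \<mu> * d2" and "e2 = - sgn \<mu> * d1"
  have \<mu>0: "\<bar>\<mu>\<bar> > 0" using \<mu> assms(1) by (auto simp: prod_eq_iff)
  have \<alpha>: "fst \<alpha> = \<bar>\<mu>\<bar> * e1" "snd \<alpha> = \<bar>\<mu>\<bar> * e2"
    by (auto simp: \<mu> e1_def e2_def sgn_if abs_if)
  have sgn: "sgn \<mu> \<in> \<rat>" by (auto simp: sgn_if)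
  have "e1 \<in> \<rat>" "e2 \<in> \<rat>" "e1 * fst u + e2 * snd u \<in> \<rat>"
    using rat sgn
      by (auto simp: e1_def e2_def d1_def d2_def intro!: Rats_add Rats_mult Rats_diff
          Rats_minus_iff[THEN iffD2])
  then obtain N a b c where N: "N > 0" "of_int N * e1 = of_int a" "of_int N * e2 = of_int b"
    "of_int N * (e1 * fst u + e2 * snd u) = of_int c"
    by (rule Rats_common_denominator)
  show thesis
  proof (rule that[of a b c])
    fix x :: "real \<times> real"
    have "\<alpha> \<bullet> x < \<beta> \<longleftrightarrow>
        \<bar>\<mu>\<bar> * (e1 * fst x + e2 * snd x) < \<bar>\<mu>\<bar> * (e1 * fst u + e2 * snd u)"
      unfolding assms(3)[symmetric] by (simp add: inner_prod_def \<alpha> algebra_simps)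
    also have "\<dots> \<longleftrightarrow> e1 * fst x + e2 * snd x < e1 * fst u + e2 * snd u"
      using \<mu>0 by (rule mult_less_cancel_left_pos)
    also have "\<dots> \<longleftrightarrow>
        of_int N * (e1 * fst x + e2 * snd x) < of_int N * (e1 * fst u + e2 * snd u)"
      using N(1) by (subst mult_less_cancel_left_pos) auto
    also have "of_int N * (e1 * fst x + e2 * snd x) = of_int a * fst x + of_int b * snd x"
      by (simp add: N(2,3)[symmetric] algebra_simps)
    finally show "\<alpha> \<bullet> x < \<beta> \<longleftrightarrow> of_int a * fst x + of_int b * snd x < of_int c"
      unfolding N(4) .
  qed
qed

text \<open>A polytope is the convex hull of its extreme points, and the hull of at most one point
  has dimension at most 0.\<close>

lemma two_extreme_points:
  fixes F :: "'a::euclidean_space set"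
  assumes "polytope F" "aff_dim F > 0"
  obtains u v where "u extreme_point_of F" "v extreme_point_of F" "u \<noteq> v"
proof -
  have F: "F = convex hull {x. x extreme_point_of F}"
    using assms by (intro Krein_Milman_Minkowski polytope_imp_compact polytope_imp_convex)
  have "\<not> {x. x extreme_point_of F} \<subseteq> {u}" for u
  proof
    assume "{x. x extreme_point_of F} \<subseteq> {u}"
    then have "aff_dim F \<le> aff_dim {u}"
      by (metis F aff_dim_convex_hull aff_dim_subset)
    then show False using assms(2) by simp
  qed
  then show thesis using that by blast
qed

text \<open>In a minimal description by half-planes each boundary line meets \<open>B\<close> in a
  facet. That facet is an edge, and its two end points are vertices of \<open>B\<close>, hence
  rational, so the half-plane has integer coefficients. As \<open>B\<close> has full dimension, its
  interior is given by the strict inequalities.\<close>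

lemma interior_rational_convex_polygon:
  assumes "rational_convex_polygon B"
  obtains H :: "(int \<times> int \<times> int) set" where "finite H"
    "interior B = {x. \<forall>(a, b, c)\<in>H. of_int a * fst x + of_int b * snd x < of_int c}"
proof -
  have B: "polytope B" "aff_dim B = 2"
    and ext: "\<And>v. v extreme_point_of B \<Longrightarrow> fst v \<in> \<rat> \<and> snd v \<in> \<rat>"
    using assms by (auto simp: rational_convex_polygon_def)
  have aff: "affine hull B = UNIV"
    using B(2) by (intro affine_hull_UNIV) simp
  \<comment> \<open>Minimality of \<open>F\<close> is what makes every half-plane of the family cut
    out a facet.\<close>
  obtain F where F: "finite F" "B = affine hull B \<inter> \<Inter>F"
    "\<forall>h\<in>F. \<exists>a b. a \<noteq> 0 \<and> h = {x. a \<bullet> x \<le> b}"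
    "\<forall>F'. F' \<subset> F \<longrightarrow> B \<subset> affine hull B \<inter> \<Inter>F'"
    using polytope_imp_polyhedron[OF B(1)] unfolding polyhedron_Int_affine_minimal by meson
  obtain \<alpha> \<beta> where h: "\<And>h. h \<in> F \<Longrightarrow> \<alpha> h \<noteq> 0 \<and> h = {x. \<alpha> h \<bullet> x \<le> \<beta> h}"
    using F(3) by metis
  have "\<exists>a b c :: int. \<forall>x. \<alpha> h \<bullet> x < \<beta> h \<longleftrightarrow> of_int a * fst x + of_int b * snd x < of_int c"
    if "h \<in> F" for h
  proof -
    let ?C = "B \<inter> {x. \<alpha> h \<bullet> x = \<beta> h}"
    have C: "?C facet_of B"
      using facet_of_polyhedron_explicit[OF F(1,2) h] F(4) that by blast
    then have "polytope ?C" "aff_dim ?C > 0"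
      using B by (auto simp: facet_of_def intro: face_of_polytope_polytope)
    then obtain u v where uv: "u extreme_point_of ?C" "v extreme_point_of ?C" "u \<noteq> v"
      by (rule two_extreme_points)
    then have "u extreme_point_of B" "v extreme_point_of B" and on: "\<alpha> h \<bullet> u = \<beta> h" "\<alpha> h \<bullet> v = \<beta> h"
      using C extreme_point_of_face unfolding facet_of_def by blast+
    then have rat: "fst u \<in> \<rat>" "snd u \<in> \<rat>" "fst v \<in> \<rat>" "snd v \<in> \<rat>"
      using ext by auto
    have "\<alpha> h \<noteq> 0" using h that by blast
    then obtain a b c :: int where
      "\<And>x. \<alpha> h \<bullet> x < \<beta> h \<longleftrightarrow> of_int a * fst x + of_int b * snd x < of_int c"
      using rational_halfplane[OF _ uv(3) on rat] by blast
    then show ?thesis by blast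
  qed
  then obtain a b c :: "(real \<times> real) set \<Rightarrow> int" where abc:
    "\<And>h x. h \<in> F \<Longrightarrow> \<alpha> h \<bullet> x < \<beta> h \<longleftrightarrow> of_int (a h) * fst x + of_int (b h) * snd x < of_int (c h)"
    by metis
  have "interior B = rel_interior B"
    using aff by (simp add: rel_interior_interior)
  also have "\<dots> = {x \<in> B. \<forall>h\<in>F. \<alpha> h \<bullet> x < \<beta> h}"
    using rel_interior_polyhedron_explicit[OF F(1,2) h] F(4) by blast
  also have "\<dots> = {x. \<forall>h\<in>F. \<alpha> h \<bullet> x < \<beta> h}"
  proof -
    have "x \<in> B" if "\<forall>h\<in>F. \<alpha> h \<bullet> x < \<beta> h" for x
    proof -
      have "x \<in> \<Inter>F" using that h by fastforce
      then show ?thesis using F(2) aff by auto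
    qed
    then show ?thesis by blast
  qed
  also have "\<dots> = {x. \<forall>(a, b, c)\<in>(\<lambda>h. (a h, b h, c h)) ` F.
      of_int a * fst x + of_int b * snd x < of_int c}"
    using abc by auto
  finally show thesis using F(1) by (intro that[of "(\<lambda>h. (a h, b h, c h)) ` F"]) auto
qed

section \<open>Lattice points of dilated boards\<close>

lemma board_points_iff:
  assumes "t > 0"
  shows "p \<in> board_points B t \<longleftrightarrow> (of_int (fst p) / real t, of_int (snd p) / real t) \<in> interior B"
proof
  assume "p \<in> board_points B t"
  then obtain x where "x \<in> interior B" "(of_int (fst p), of_int (snd p)) = real t *\<^sub>R x"
    unfolding board_points_def by blast
  then show "(of_int (fst p) / real t, of_int (snd p) / real t) \<in> interior B"
    using assms by (cases x) (simp add: scaleR_prod_def)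
next
  assume "(of_int (fst p) / real t, of_int (snd p) / real t) \<in> interior B"
  moreover have "(real_of_int (fst p), real_of_int (snd p)) =
      real t *\<^sub>R (of_int (fst p) / real t, of_int (snd p) / real t)"
    using assms by simp
  ultimately show "p \<in> board_points B t"
    unfolding board_points_def by blast
qed

text \<open>Multiplication by \<open>t\<close> turns the constant \<open>c\<close> into
  \<open>c * int t\<close>, which makes the inequalities homogeneous in the coordinates and the
  dilation factor together.\<close>

lemma board_points_halfplanes:
  assumes "rational_convex_polygon B"
  obtains H where "finite H"
    "\<And>t p. t > 0 \<Longrightarrow> p \<in> board_points B t \<longleftrightarrow>
      (\<forall>(a, b, c)\<in>H. a * fst p + b * snd p < c * int t)"
proof -
  obtain H where H: "finite H"
    "interior B = {x. \<forall>(a, b, c)\<in>H. of_int a * fst x + of_int b * snd x < of_int c}"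
    using interior_rational_convex_polygon[OF assms] .
  have "of_int a * (of_int (fst p) / real t) + of_int b * (of_int (snd p) / real t) < of_int c \<longleftrightarrow>
      a * fst p + b * snd p < c * int t" if "t > 0" for t p and a b c :: int
  proof -
    have "of_int a * (of_int (fst p) / real t) + of_int b * (of_int (snd p) / real t) < of_int c \<longleftrightarrow>
        real_of_int (a * fst p + b * snd p) < of_int (c * int t)"
      using that by (simp add: field_simps)
    then show ?thesis by (simp only: of_int_less_iff)
  qed
  then show thesis
    using that H by (simp add: board_points_iff)
qed

lemma board_points_bounded:
  assumes "bounded B"
  obtains K where "K > 0" 
    "\<And>t p. t > 0 \<Longrightarrow> p \<in> board_points B t \<Longrightarrow> \<bar>fst p\<bar> < K * int t \<and> \<bar>snd p\<bar> < K * int t"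
proof -
  obtain k where k: "\<And>x. x \<in> interior B \<Longrightarrow> norm x \<le> k"
    using bounded_subset[OF assms interior_subset] unfolding bounded_iff by blast
  \<comment> \<open>The absolute value makes \<open>K\<close> positive even if the interior is empty
    and \<open>k\<close> negative; the added 1 makes the bounds strict, as the open summation range
    demands.\<close>
  define K where "K = \<lceil>\<bar>k\<bar>\<rceil> + 1"
  have kK: "k < of_int K" unfolding K_def by linarith
  show thesis
  proof (rule that[of K])
    show "K > 0" unfolding K_def by linarith
    fix t p assume t: "(t::nat) > 0" and p: "p \<in> board_points B t"
    then have "norm (of_int (fst p) / real t, of_int (snd p) / real t) \<le> k"
      using k board_points_iff by blast
    then have "\<bar>of_int (fst p) / real t\<bar> < of_int K" "\<bar>of_int (snd p) / real t\<bar> < of_int K"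
      using kK norm_fst_le[of "of_int (fst p) / real t" "of_int (snd p) / real t"]
        norm_snd_le[of "of_int (snd p) / real t" "of_int (fst p) / real t"] by auto
    then have "real_of_int \<bar>fst p\<bar> < of_int (K * int t)" "real_of_int \<bar>snd p\<bar> < of_int (K * int t)"
      using t by (simp_all add: field_simps)
    then show "\<bar>fst p\<bar> < K * int t \<and> \<bar>snd p\<bar> < K * int t"
      by (simp only: of_int_less_iff)
  qed
qed

subsection \<open>Counting configurations\<close>

text \<open>Iterated elimination: the variable with the highest index is summed out first, and
  \<open>y 0\<close> is never summed, so the ranges stay the same throughout.\<close>

lemma pw_quasipoly_sum_box:
  assumes "pw_quasipoly (Suc n) f"
  shows "pw_quasipoly 1 (\<lambda>y. \<Sum>w\<in>{1..n} \<rightarrow>\<^sub>E {- (K * y 0)<..<K * y 0}. f (\<lambda>i. if i \<in> {1..n} then w i else y i))"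
  using assms
proof (induction n arbitrary: f)
  case 0
  then show ?case by simp
next
  case (Suc n)
  let ?I = "\<lambda>y. {- (K * y 0)<..<K * y 0}"
  let ?v = "\<lambda>y w n. \<lambda>i. if i \<in> {1..n} then w i else y i"
  have zero: "(if (0::nat) \<in> {1..n} then w 0 else y 0) = y 0" for w y :: "nat \<Rightarrow> int"
    by simp
  have step: "(\<Sum>w\<in>{1..n} \<rightarrow>\<^sub>E ?I y. \<Sum>x\<in>?I y. f ((?v y w n)(Suc n := x))) =
      (\<Sum>w\<in>{1..Suc n} \<rightarrow>\<^sub>E ?I y. f (?v y w (Suc n)))" for y
  proof -
    have upd: "?v y (w(Suc n := x)) (Suc n) = (?v y w n)(Suc n := x)" for w x
      by auto
    have "{1..Suc n} \<rightarrow>\<^sub>E ?I y = (\<lambda>(x, w). w(Suc n := x)) ` (?I y \<times> ({1..n} \<rightarrow>\<^sub>E ?I y))"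
      by (subst PiE_insert_eq[symmetric]) (simp add: atLeastAtMostSuc_conv)
    moreover have "inj_on (\<lambda>(x, w). w(Suc n := x)) (?I y \<times> ({1..n} \<rightarrow>\<^sub>E ?I y))"
      by (rule inj_combinator) simp
    ultimately have "(\<Sum>w\<in>{1..Suc n} \<rightarrow>\<^sub>E ?I y. f (?v y w (Suc n))) =
        (\<Sum>(x, w)\<in>?I y \<times> ({1..n} \<rightarrow>\<^sub>E ?I y). f (?v y (w(Suc n := x)) (Suc n)))"
      by (simp only: sum.reindex) (simp add: case_prod_unfold)
    also have "\<dots> = (\<Sum>x\<in>?I y. \<Sum>w\<in>{1..n} \<rightarrow>\<^sub>E ?I y. f (?v y (w(Suc n := x)) (Suc n)))"
      by (rule sum.cartesian_product[symmetric])
    also have "\<dots> = (\<Sum>w\<in>{1..n} \<rightarrow>\<^sub>E ?I y. \<Sum>x\<in>?I y. f (?v y (w(Suc n := x)) (Suc n)))"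
      by (rule sum.swap)
    finally show ?thesis by (simp only: upd)
  qed
  show ?case using Suc.IH[OF pw_quasipoly_sum_var[OF Suc.prems, of K]] by (simp only: zero step)
qed

lemma quasipoly_count_box:
  assumes "pw_quasipoly (Suc n) (\<lambda>y. of_bool (P y))"
  obtains u where "quasipoly u"
    "\<And>t. t > 0 \<Longrightarrow> u t = real (card {w \<in> {1..n} \<rightarrow>\<^sub>E {- (K * t)<..<K * t}. P (\<lambda>i. if i \<in> {1..n} then w i else t)})"
proof -
  obtain u where u: "quasipoly u" "\<And>y. y 0 > 0 \<Longrightarrow> u (y 0) =
      (\<Sum>w\<in>{1..n} \<rightarrow>\<^sub>E {- (K * y 0)<..<K * y 0}. of_bool (P (\<lambda>i. if i \<in> {1..n} then w i else y i)))"
    using pw_quasipoly_1_imp_quasipoly[OF pw_quasipoly_sum_box[OF assms, of K]] by auto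
  show thesis
  proof (rule that[OF u(1)])
    fix t :: int assume "t > 0"
    then show "u t = real (card {w \<in> {1..n} \<rightarrow>\<^sub>E {- (K * t)<..<K * t}. P (\<lambda>i. if i \<in> {1..n} then w i else t)})"
      using u(2)[of "\<lambda>_. t"] by (simp add: finite_PiE Int_def)
  qed
qed

text \<open>Piece \<open>i\<close> has the coordinates \<open>y (2 * i + 1)\<close> and \<open>y (2 * i + 2)\<close>, and \<open>y 0\<close> is the dilation factor.\<close>

definition config_cond
    :: "lattice_point set \<Rightarrow> (int \<times> int \<times> int) set \<Rightarrow> nat \<Rightarrow> (nat \<Rightarrow> int) \<Rightarrow> bool" where
  "config_cond M H q y \<longleftrightarrow>
    (\<forall>i\<in>{..<q}. \<forall>(a, b, c)\<in>H. a * y (2 * i + 1) + b * y (2 * i + 2) < c * y 0) \<and>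
    (\<forall>i\<in>{..<q}. \<forall>j\<in>{..<q} - {i}. \<forall>m\<in>M. \<not>
      snd m * (y (2 * j + 1) - y (2 * i + 1)) = fst m * (y (2 * j + 2) - y (2 * i + 2)))"

lemma pw_quasipoly_config_cond:
  assumes "finite M" "finite H"
  shows "pw_quasipoly (Suc (2 * q)) (\<lambda>y. of_bool (config_cond M H q y))"
  unfolding config_cond_def case_prod_unfold
  by (intro pw_quasipoly_conj pw_quasipoly_ball pw_quasipoly_not pw_quasipoly_less
      pw_quasipoly_eq linform_add linform_diff linform_scale linform_var finite_Diff
      finite_lessThan assms) auto

text \<open>Listing the coordinates of the pieces is a bijection between configurations and
  extensional functions on \<open>{1..2 * q}\<close>. The box loses nothing, since it contains every
  board point.\<close>

lemma o_count_eq_card_box: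
  assumes H: "\<And>p. p \<in> board_points B t \<longleftrightarrow> (\<forall>(a, b, c)\<in>H. a * fst p + b * snd p < c * int t)"
    and box: "\<And>p. p \<in> board_points B t \<Longrightarrow> \<bar>fst p\<bar> < L \<and> \<bar>snd p\<bar> < L"
    and "t > 0"
  shows "o_count M B q (t - 1) = card {w \<in> {1..2 * q} \<rightarrow>\<^sub>E {- L<..<L}.
    config_cond M H q (\<lambda>i. if i \<in> {1..2 * q} then w i else int t)}"
proof -
  let ?W = "{w \<in> {1..2 * q} \<rightarrow>\<^sub>E {- L<..<L}. config_cond M H q (\<lambda>i. if i \<in> {1..2 * q} then w i else int t)}"
  let ?Z = "labelled_configs M B q (t - 1)"
  define \<psi> :: "(nat \<Rightarrow> int) \<Rightarrow> lattice_point list" where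
    "\<psi> w = map (\<lambda>i. (w (2 * i + 1), w (2 * i + 2))) [0..<q]" for w
  have set_iff: "set z \<subseteq> board_points B t \<longleftrightarrow> (\<forall>i<q. z ! i \<in> board_points B t)" if "length z = q"
      for z
    using that by (auto simp: set_conv_nth)
  have len: "length (\<psi> w) = q" and nth: "i < q \<Longrightarrow> \<psi> w ! i = (w (2 * i + 1), w (2 * i + 2))" for w i
    by (simp_all add: \<psi>_def)
  have \<psi>_iff: "\<psi> w \<in> ?Z \<longleftrightarrow> config_cond M H q (\<lambda>i. if i \<in> {1..2 * q} then w i else int t)" for w
  proof -
    have "\<psi> w \<in> ?Z \<longleftrightarrow> (\<forall>i<q. \<forall>(a, b, c)\<in>H. a * w (2 * i + 1) + b * w (2 * i + 2) < c * int t) \<and>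
      (\<forall>i<q. \<forall>j<q. i \<noteq> j \<longrightarrow> (\<forall>m\<in>M.
        snd m * (w (2 * j + 1) - w (2 * i + 1)) \<noteq> fst m * (w (2 * j + 2) - w (2 * i + 2))))"
      using assms(3)
        by (simp add: labelled_configs_def set_iff[OF len] len nth H dot_def perp_def mult.commute)
    also have "\<dots> \<longleftrightarrow> config_cond M H q (\<lambda>i. if i \<in> {1..2 * q} then w i else int t)"
      unfolding config_cond_def by simp blast
    finally show ?thesis .
  qed
  have "bij_betw \<psi> ?W ?Z"
  proof (rule bij_betwI')
    fix v w assume v: "v \<in> ?W" and w: "w \<in> ?W"
    show "\<psi> v = \<psi> w \<longleftrightarrow> v = w"
    proof
      assume eq: "\<psi> v = \<psi> w"
      have pair: "v (2 * i + 1) = w (2 * i + 1)" "v (2 * i + 2) = w (2 * i + 2)" if "i < q" for i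
        using arg_cong[OF eq, of "\<lambda>z. z ! i"] that by (auto simp: \<psi>_def)
      have "v k = w k" if "k \<in> {1..2 * q}" for k
      proof (cases "odd k")
        case True
        then obtain i where "k = 2 * i + 1" by (rule oddE)
        then show ?thesis using pair(1)[of i] that by auto
      next
        case False
        then obtain i where "k = 2 * i" by (auto elim: evenE)
        \<comment> \<open>An even index \<open>2 * i\<close> in the range has \<open>i > 0\<close>
          and is the second coordinate of piece \<open>i - 1\<close>.\<close>
        then show ?thesis using pair(2)[of "i - 1"] that by (cases i) auto
      qed
      moreover have "v \<in> {1..2 * q} \<rightarrow>\<^sub>E {- L<..<L}" "w \<in> {1..2 * q} \<rightarrow>\<^sub>E {- L<..<L}"
        using v w by blast+
      ultimately show "v = w" by (blast intro: PiE_ext)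
    qed simp
  next
    fix w assume "w \<in> ?W"
    then show "\<psi> w \<in> ?Z" using \<psi>_iff[of w] by blast
  next
    fix z assume z: "z \<in> ?Z"
    \<comment> \<open>The inverse of \<psi>: both indices \<open>2 * i + 1\<close> and
      \<open>2 * i + 2\<close> give \<open>(k - 1) div 2 = i\<close>, and parity selects the
      coordinate.\<close>
    define w where "w = (\<lambda>k\<in>{1..2 * q}. if odd k then fst (z ! ((k - 1) div 2)) else snd (z ! ((k - 1) div 2)))"
    have len: "length z = q" using z by (simp add: labelled_configs_def)
    have "\<psi> w = z"
      using len by (intro nth_equalityI) (auto simp: \<psi>_def w_def)
    moreover have "w \<in> {1..2 * q} \<rightarrow>\<^sub>E {- L<..<L}"
    proof -
      have "z ! i \<in> board_points B t" if "i < q" for i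
        using z len that assms(3) nth_mem[of i z] by (auto simp: labelled_configs_def)
      then have "- L < fst (z ! i) \<and> fst (z ! i) < L \<and> - L < snd (z ! i) \<and> snd (z ! i) < L" if
          "i < q" for i
        using box[of "z ! i"] that by (simp add: abs_less_iff minus_less_iff)
      moreover have "(k - 1) div 2 < q" if "k \<in> {1..2 * q}" for k using that by auto
      ultimately show ?thesis by (auto simp: w_def)
    qed
    ultimately show "\<exists>w\<in>?W. z = \<psi> w" using z \<psi>_iff[of w] by blast
  qed
  then show ?thesis unfolding o_count_def by (simp add: bij_betw_same_card)
qed

lemma o_count_quasipoly:
  assumes "piece M" "rational_convex_polygon B"
  obtains u where "quasipoly u" "\<And>t. t > 0 \<Longrightarrow> real (o_count M B q (t - 1)) = u (int t)"
proof -
  obtain H where H: "finite H" "\<And>t p. t > 0 \<Longrightarrow> p \<in> board_points B t \<longleftrightarrow>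
      (\<forall>(a, b, c)\<in>H. a * fst p + b * snd p < c * int t)"
    using board_points_halfplanes[OF assms(2)] by blast
  have "bounded B"
    using assms(2) by (simp add: rational_convex_polygon_def polytope_imp_bounded)
  then obtain K where K: "\<And>t p. t > 0 \<Longrightarrow> p \<in> board_points B t \<Longrightarrow>
      \<bar>fst p\<bar> < K * int t \<and> \<bar>snd p\<bar> < K * int t"
    using board_points_bounded by metis
  have "finite M" using assms(1) by (simp add: piece_def)
  then obtain u where "quasipoly u"
      "\<And>t. t > 0 \<Longrightarrow> u t = real (card {w \<in> {1..2 * q} \<rightarrow>\<^sub>E {- (K * t)<..<K * t}.
      config_cond M H q (\<lambda>i. if i \<in> {1..2 * q} then w i else t)})"
    using quasipoly_count_box[OF pw_quasipoly_config_cond[OF _ H(1)], of M q K] by blast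
  then show thesis
    using that[of u] o_count_eq_card_box[OF H(2) K] by simp
qed

subsection \<open>Asymptotics of the counts\<close>

lemma tendsto_floor_scaled:
  "(\<lambda>n. of_int \<lfloor>real (Suc n) * x\<rfloor> / real (Suc n)) \<longlonglongrightarrow> x"
proof (rule tendsto_sandwich)
  show "\<forall>\<^sub>F n in sequentially. x - inverse (real (Suc n)) \<le> of_int \<lfloor>real (Suc n) * x\<rfloor> / real (Suc n)"
  proof (rule always_eventually, rule allI)
    fix n
    have "(x - inverse (real (Suc n))) * real (Suc n) = real (Suc n) * x - 1"
      by (simp add: left_diff_distrib del: of_nat_Suc)
    also have "\<dots> \<le> of_int \<lfloor>real (Suc n) * x\<rfloor>" by linarith
    finally show "x - inverse (real (Suc n)) \<le> of_int \<lfloor>real (Suc n) * x\<rfloor> / real (Suc n)"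
      by (simp add: pos_le_divide_eq del: of_nat_Suc)
  qed
  show "\<forall>\<^sub>F n in sequentially. of_int \<lfloor>real (Suc n) * x\<rfloor> / real (Suc n) \<le> x"
    by (intro always_eventually allI) (simp add: pos_divide_le_eq mult.commute del: of_nat_Suc)
  show "(\<lambda>n. x - inverse (real (Suc n))) \<longlonglongrightarrow> x"
    using tendsto_diff[OF tendsto_const LIMSEQ_inverse_real_of_nat, of x] by simp
qed simp

lemma measure_lborel_cell:
  fixes a b c d :: real
  assumes "a \<le> b" "c \<le> d"
  shows "measure lborel ({a..<b} \<times> {c..<d}) = (b - a) * (d - c)"
    and "emeasure lborel ({a..<b} \<times> {c..<d}) < \<infinity>"
proof -
  have "emeasure lborel ({a..<b} \<times> {c..<d}) = ennreal (b - a) * ennreal (d - c)"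
    using assms by (simp add: lborel_prod[symmetric] lborel.emeasure_pair_measure_Times)
  then have *: "emeasure lborel ({a..<b} \<times> {c..<d}) = ennreal ((b - a) * (d - c))"
    using assms by (simp add: ennreal_mult)
  then show "measure lborel ({a..<b} \<times> {c..<d}) = (b - a) * (d - c)"
    using assms by (simp add: measure_def)
  show "emeasure lborel ({a..<b} \<times> {c..<d}) < \<infinity>" by (simp add: *)
qed

text \<open>Half-open squares of side \<open>1 / real (Suc n)\<close> with lower left corners at the
  scaled lattice points tile the plane. Hence the scaled count is the integral of
  \<open>g n\<close>, which tests whether the corner of the square containing \<open>x\<close> is
  interior. The corners tend to \<open>x\<close>, so \<open>g n\<close> converges off the frontier,
  a null set by convexity, and dominated convergence applies.\<close>

lemma board_points_asymptotics:
  assumes B: "bounded B" "convex B"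
  shows "(\<lambda>n. real (card (board_points B (Suc n))) / real (Suc n) ^ 2) \<longlonglongrightarrow> measure lebesgue B"
proof -
  define corner :: "nat \<Rightarrow> real \<times> real \<Rightarrow> real \<times> real" where
    "corner n x = (of_int \<lfloor>real (Suc n) * fst x\<rfloor> / real (Suc n),
      of_int \<lfloor>real (Suc n) * snd x\<rfloor> / real (Suc n))" for n x
  define cell :: "nat \<Rightarrow> lattice_point \<Rightarrow> (real \<times> real) set" where
    "cell n p = {of_int (fst p) / real (Suc n)..<(of_int (fst p) + 1) / real (Suc n)} \<times>
      {of_int (snd p) / real (Suc n)..<(of_int (snd p) + 1) / real (Suc n)}" for n p
  define g :: "nat \<Rightarrow> real \<times> real \<Rightarrow> real" where "g n x = indicator (interior B) (corner n x)" for n x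
  have cell: "x \<in> cell n p \<longleftrightarrow> p = (\<lfloor>real (Suc n) * fst x\<rfloor>, \<lfloor>real (Suc n) * snd x\<rfloor>)" for n p x
    unfolding cell_def
    by (cases p; cases x)
      (auto simp: pos_divide_le_eq pos_less_divide_eq floor_eq_iff eq_commute[of _ "\<lfloor>_\<rfloor>"]
          mult.commute
        simp del: of_nat_Suc)
  have fin: "finite (board_points B t)" for t
    using finite_board_points[OF B(1)] .
  have g: "g n x = (\<Sum>p\<in>board_points B (Suc n). indicator (cell n p) x)" for n x
  proof -
    let ?p = "(\<lfloor>real (Suc n) * fst x\<rfloor>, \<lfloor>real (Suc n) * snd x\<rfloor>)"
    have "(\<Sum>p\<in>board_points B (Suc n). indicator (cell n p) x) =
        (\<Sum>p\<in>board_points B (Suc n). if p = ?p then 1 else (0::real))"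
      by (intro sum.cong refl) (simp only: indicator_def cell of_bool_def)
    also have "\<dots> = of_bool (?p \<in> board_points B (Suc n))"
      using fin by simp
    also have "\<dots> = g n x"
      unfolding g_def corner_def by (simp add: board_points_iff indicator_def del: of_nat_Suc)
    finally show ?thesis by simp
  qed
  have cell_fin: "emeasure lborel (cell n p) < \<infinity>"
    and cell_meas: "measure lborel (cell n p) = 1 / real (Suc n) ^ 2" for n p
  proof -
    have "(of_int k + 1) / real (Suc n) - of_int k / real (Suc n) = 1 / real (Suc n)" for k :: int
      by (simp add: diff_divide_distrib[symmetric])
    then show "emeasure lborel (cell n p) < \<infinity>" "measure lborel (cell n p) = 1 / real (Suc n) ^ 2"
      unfolding cell_def
      by (subst measure_lborel_cell | simp add: divide_right_mono power2_eq_square del: of_nat_Suc)+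
  qed
  have cell_borel: "cell n p \<in> sets lborel" for n p
    unfolding cell_def by (simp add: borel_prod[symmetric])
  have integral_g: "integral\<^sup>L lborel (g n) = real (card (board_points B (Suc n))) / real (Suc n) ^ 2" for n
    unfolding g using cell_fin cell_borel cell_meas
    by (subst Bochner_Integration.integral_sum) auto
  have "(\<lambda>n. integral\<^sup>L lborel (g n)) \<longlonglongrightarrow> integral\<^sup>L lborel (indicator (interior B) :: _ \<Rightarrow> real)"
  proof -
    obtain k where k: "\<And>x. x \<in> B \<Longrightarrow> norm x \<le> k"
      using B(1) unfolding bounded_iff by blast
    \<comment> \<open>Each coordinate of \<open>x\<close> exceeds that of its corner by at most 1,
      so enlarging the bound \<open>k\<close> by 1 covers all supports at once.\<close>
    define D :: "(real \<times> real) set" where "D = cbox (- k - 1, - k - 1) (k + 1, k + 1)"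
    show ?thesis
    proof (rule integral_dominated_convergence[where w = "indicator D"])
      show "indicator (interior B) \<in> borel_measurable lborel" by simp
      show "g n \<in> borel_measurable lborel" for n
        unfolding g using cell_borel by (intro borel_measurable_sum borel_measurable_indicator) auto
      show "integrable lborel (indicator D :: _ \<Rightarrow> real)"
        unfolding D_def by (intro integrable_real_indicator emeasure_lborel_cbox_finite) auto
      have "negligible (frontier B)"
        using B(2) by (rule negligible_convex_frontier)
      then have "AE x in lebesgue. x \<notin> frontier B"
        by (intro AE_not_in) (simp add: negligible_iff_null_sets)
      then have "AE x in lborel. x \<notin> frontier B"
        by (simp add: AE_completion_iff)
      then show "AE x in lborel. (\<lambda>n. g n x) \<longlonglongrightarrow> indicator (interior B) x"
      proof (rule AE_mp, intro AE_I2 impI)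
        fix x assume x: "x \<notin> frontier B"
        have lim: "(\<lambda>n. corner n x) \<longlonglongrightarrow> x"
          unfolding corner_def using
              tendsto_Pair[OF tendsto_floor_scaled tendsto_floor_scaled, of "fst x" "snd x"]
          by simp
        show "(\<lambda>n. g n x) \<longlonglongrightarrow> indicator (interior B) x"
        proof (cases "x \<in> interior B")
          case True
          then have "\<forall>\<^sub>F n in sequentially. corner n x \<in> interior B"
            by (intro topological_tendstoD[OF lim]) auto
          then show ?thesis
            using True by (intro tendsto_eventually) (auto simp: g_def elim: eventually_mono)
        next
          case False
          \<comment> \<open>Off the frontier a non-interior point lies in the open complement of the
            closure, which the corners eventually enter.\<close>
          then have "x \<in> - closure B" using x by (auto simp: frontier_def)
          then have "\<forall>\<^sub>F n in sequentially. corner n x \<in> - closure B"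
            by (intro topological_tendstoD[OF lim]) auto
          then show ?thesis
            using False interior_subset[of B] closure_subset[of B]
            by (intro tendsto_eventually) (auto simp: g_def indicator_def elim!: eventually_mono)
        qed
      qed
      show "AE x in lborel. norm (g n x) \<le> indicator D x" for n
      proof (rule AE_I2)
        fix x :: "real \<times> real"
        have "x \<in> D" if "corner n x \<in> interior B"
        proof -
          have "norm (corner n x) \<le> k" using that k interior_subset by blast
          then have norm: "\<bar>fst (corner n x)\<bar> \<le> k" "\<bar>snd (corner n x)\<bar> \<le> k"
            using norm_fst_le[of "fst (corner n x)" "snd (corner n x)"]
              norm_snd_le[of "snd (corner n x)" "fst (corner n x)"] by auto
          have near: "of_int \<lfloor>real (Suc n) * s\<rfloor> / real (Suc n) \<le> s"
            "s \<le> of_int \<lfloor>real (Suc n) * s\<rfloor> / real (Suc n) + 1" for s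
          proof -
            show "of_int \<lfloor>real (Suc n) * s\<rfloor> / real (Suc n) \<le> s"
              by (simp add: pos_divide_le_eq mult.commute del: of_nat_Suc)
            have "s * real (Suc n) \<le> of_int \<lfloor>real (Suc n) * s\<rfloor> + 1"
              by (simp add: mult.commute del: of_nat_Suc)
            also have "\<dots> \<le> of_int \<lfloor>real (Suc n) * s\<rfloor> + real (Suc n)" by simp
            also have "\<dots> = (of_int \<lfloor>real (Suc n) * s\<rfloor> / real (Suc n) + 1) * real (Suc n)"
              by (simp add: distrib_right del: of_nat_Suc)
            finally show "s \<le> of_int \<lfloor>real (Suc n) * s\<rfloor> / real (Suc n) + 1"
              by (rule mult_right_le_imp_le) simp
          qed
          have "fst (corner n x) \<le> fst x" "fst x \<le> fst (corner n x) + 1"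
            "snd (corner n x) \<le> snd x" "snd x \<le> snd (corner n x) + 1"
            unfolding corner_def fst_conv snd_conv by (fact near)+
          then have "- k - 1 \<le> fst x \<and> fst x \<le> k + 1 \<and> - k - 1 \<le> snd x \<and> snd x \<le> k + 1"
            using norm by linarith
          then show ?thesis
            unfolding D_def by (cases x) (simp add: cbox_Pair_eq)
        qed
        then show "norm (g n x) \<le> indicator D x" by (auto simp: g_def indicator_def)
      qed
    qed
  qed
  moreover have "measure lborel (interior B) = measure lebesgue B"
  proof -
    have "measure lborel (interior B) = measure lebesgue (interior B)" by simp
    also have "\<dots> = measure lebesgue B"
      by (intro measure_interior negligible_convex_frontier B)
    finally show ?thesis .
  qed
  ultimately show ?thesis by (simp add: integral_g)
qed

text \<open>An attack along \<open>m\<close> confines \<open>z ! j\<close> to the line through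
  \<open>z ! i\<close> in direction \<open>m\<close>. One suitable coordinate then determines it, so
  a factor \<open>card P\<close> is replaced by the number of values of that coordinate.\<close>

lemma card_attacking_le:
  assumes "m \<noteq> 0" "finite P" "i < q" "j < q" "i \<noteq> j"
    and box: "\<And>p. p \<in> P \<Longrightarrow> \<bar>fst p\<bar> < L \<and> \<bar>snd p\<bar> < L"
  shows "card {z. length z = q \<and> set z \<subseteq> P \<and> dot (z ! j - z ! i) (perp m) = 0}
    \<le> card P ^ (q - 1) * nat (2 * L)"
proof -
  let ?A = "{z. length z = q \<and> set z \<subseteq> P \<and> dot (z ! j - z ! i) (perp m) = 0}"
  let ?R = "{..<q} - {j}"
  \<comment> \<open>A coordinate in which \<open>m\<close> has a nonzero component is injective on
    lines in direction \<open>m\<close>.\<close>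
  define coord :: "lattice_point \<Rightarrow> int" where "coord p = (if fst m \<noteq> 0 then fst p else snd p)" for p
  define \<phi> where "\<phi> z = (restrict (nth z) ?R, coord (z ! j))" for z
  have "inj_on \<phi> ?A"
  proof (rule inj_onI)
    fix z w assume z: "z \<in> ?A" and w: "w \<in> ?A" and eq: "\<phi> z = \<phi> w"
    have R: "z ! k = w ! k" if "k < q" "k \<noteq> j" for k
      using eq that unfolding \<phi>_def by (auto dest!: fun_cong[of _ _ k])
    have "snd m * (fst (z ! j) - fst (z ! i)) = fst m * (snd (z ! j) - snd (z ! i))"
      "snd m * (fst (w ! j) - fst (z ! i)) = fst m * (snd (w ! j) - snd (z ! i))"
      using z w R[OF assms(3,5)] by (auto simp: dot_def perp_def algebra_simps)
    then have "snd m * (fst (z ! j) - fst (w ! j)) = fst m * (snd (z ! j) - snd (w ! j))"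
      by (simp add: algebra_simps)
    moreover have "coord (z ! j) = coord (w ! j)" using eq by (simp add: \<phi>_def)
    ultimately have "z ! j = w ! j"
      using assms(1) by (auto simp: coord_def prod_eq_iff split: if_splits)
    then have "z ! k = w ! k" if "k < q" for k using R that by (cases "k = j") auto
    then show "z = w" using z w by (auto intro: nth_equalityI)
  qed
  moreover have "\<phi> ` ?A \<subseteq> (?R \<rightarrow>\<^sub>E P) \<times> {- L<..<L}"
  proof (rule image_subsetI)
    fix z assume z: "z \<in> ?A"
    have zP: "z ! k \<in> P" if "k < q" for k using z nth_mem[of k z] that by auto
    then have "restrict (nth z) ?R \<in> ?R \<rightarrow>\<^sub>E P" by auto
    moreover have "coord (z ! j) \<in> {- L<..<L}"
      using box[OF zP[OF assms(4)]] by (auto simp: coord_def abs_less_iff)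
    ultimately show "\<phi> z \<in> (?R \<rightarrow>\<^sub>E P) \<times> {- L<..<L}" by (simp add: \<phi>_def)
  qed
  ultimately have "card ?A \<le> card ((?R \<rightarrow>\<^sub>E P) \<times> {- L<..<L})"
    using assms(2) by (intro card_inj_on_le[of \<phi>] finite_cartesian_product finite_PiE) auto
  also have "\<dots> = card P ^ (q - 1) * card {- L<..<L}"
    using assms(2,4) by (simp add: card_cartesian_product card_PiE)
  also have "\<dots> \<le> card P ^ (q - 1) * nat (2 * L)"
    by (intro mult_left_mono) auto
  finally show ?thesis .
qed

text \<open>A union bound: every list of board points that is not a configuration has an attack for
  some triple \<open>(i, j, m)\<close>, and there are at most \<open>q * q * card M\<close>
  triples.\<close>

lemma o_count_bounds:
  assumes "piece M" "bounded B"
    and box: "\<And>p. p \<in> board_points B (n + 1) \<Longrightarrow> \<bar>fst p\<bar> < L \<and> \<bar>snd p\<bar> < L"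
  defines "N \<equiv> card (board_points B (n + 1))"
  shows "o_count M B q n \<le> N ^ q"
    and "N ^ q \<le> o_count M B q n + q * q * card M * (N ^ (q - 1) * nat (2 * L))"
proof -
  let ?P = "board_points B (n + 1)"
  let ?A = "{z. set z \<subseteq> ?P \<and> length z = q}"
  let ?bad = "\<lambda>(i, j, m). {z. length z = q \<and> set z \<subseteq> ?P \<and> dot (z ! j - z ! i) (perp m) = 0}"
  let ?I = "{(i, j, m). i < q \<and> j < q \<and> i \<noteq> j \<and> m \<in> M}"
  have fin: "finite ?P" "finite ?A"
    using finite_board_points[OF assms(2)] finite_lists_length_eq by blast+
  have card: "card ?A = N ^ q" unfolding N_def using fin(1) by (rule card_lists_length_eq)
  have sub: "labelled_configs M B q n \<subseteq> ?A" by (auto simp: labelled_configs_def)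
  then show "o_count M B q n \<le> N ^ q"
    unfolding o_count_def card[symmetric] using fin by (intro card_mono)
  have M: "finite M" "\<And>m. m \<in> M \<Longrightarrow> m \<noteq> 0" using assms(1) by (auto simp: piece_def)
  have I: "?I \<subseteq> {..<q} \<times> {..<q} \<times> M" by auto
  have finI: "finite ?I" by (rule finite_subset[OF I]) (use M in simp)
  have finbad: "finite (?bad x)" for x
    by (rule finite_subset[OF _ fin(2)]) (auto split: prod.splits)
  have "?A \<subseteq> labelled_configs M B q n \<union> (\<Union>x\<in>?I. ?bad x)"
    unfolding labelled_configs_def by fastforce
  then have "card ?A \<le> card (labelled_configs M B q n \<union> (\<Union>x\<in>?I. ?bad x))"
    using finite_subset[OF sub fin(2)] finI finbad by (intro card_mono finite_UnI finite_UN_I)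
  also have "\<dots> \<le> o_count M B q n + card (\<Union>x\<in>?I. ?bad x)"
    unfolding o_count_def by (rule card_Un_le)
  also have "card (\<Union>x\<in>?I. ?bad x) \<le> (\<Sum>x\<in>?I. card (?bad x))"
    using finI by (rule card_UN_le)
  also have "\<dots> \<le> (\<Sum>x\<in>?I. N ^ (q - 1) * nat (2 * L))"
  proof (rule sum_mono)
    fix x assume "x \<in> ?I"
    then obtain i j m where x: "x = (i, j, m)" "i < q" "j < q" "i \<noteq> j" "m \<in> M" by auto
    show "card (?bad x) \<le> N ^ (q - 1) * nat (2 * L)"
      unfolding x(1) N_def prod.case by (rule card_attacking_le[OF M(2)[OF x(5)] fin(1) x(2-4) box])
  qed
  also have "\<dots> \<le> q * q * card M * (N ^ (q - 1) * nat (2 * L))"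
    using card_mono[OF _ I] M by (simp add: card_cartesian_product mult.assoc)
  finally show "N ^ q \<le> o_count M B q n + q * q * card M * (N ^ (q - 1) * nat (2 * L))"
    by (simp only: card)
qed

text \<open>The attacking lists number at most a constant times
  \<open>real (Suc n) * real (N n) ^ (q - 1)\<close>. After division by
  \<open>real (Suc n) ^ (2 * q)\<close> this is of order \<open>1 / real (Suc n)\<close>, while all
  lists together contribute \<open>\<nu> n ^ q\<close>.\<close>

lemma o_count_asymptotics:
  assumes "piece M" "bounded B" "convex B" "q > 0"
  shows "(\<lambda>n. real (o_count M B q n) / real (Suc n) ^ (2 * q)) \<longlonglongrightarrow> measure lebesgue B ^ q"
proof -
  obtain K where K: "K > 0"
    "\<And>t p. t > 0 \<Longrightarrow> p \<in> board_points B t \<Longrightarrow> \<bar>fst p\<bar> < K * int t \<and> \<bar>snd p\<bar> < K * int t"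
    using board_points_bounded[OF assms(2)] by blast
  define N where "N n = card (board_points B (n + 1))" for n
  define \<nu> where "\<nu> n = real (N n) / real (Suc n) ^ 2" for n
  define c where "c = real (q * q * card M) * (2 * of_int K)"
  have \<nu>: "\<nu> \<longlonglongrightarrow> measure lebesgue B"
    unfolding \<nu>_def N_def using board_points_asymptotics[OF assms(2,3)] by simp
  have pow: "real (N n) ^ k = \<nu> n ^ k * real (Suc n) ^ (2 * k)" for n k
    by (simp add: \<nu>_def power_divide power_mult del: of_nat_Suc)
  show ?thesis
  proof (rule tendsto_sandwich)
    have bounds: "o_count M B q n \<le> N n ^ q"
      "N n ^ q \<le> o_count M B q n + q * q * card M * (N n ^ (q - 1) * nat (2 * (K * int (Suc n))))" for n
      unfolding N_def using o_count_bounds[OF assms(1,2), of n "K * int (Suc n)" q]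
          K(2)[of "n + 1"] by auto
    show "\<forall>\<^sub>F n in sequentially. \<nu> n ^ q - c * \<nu> n ^ (q - 1) * inverse (real (Suc n))
        \<le> real (o_count M B q n) / real (Suc n) ^ (2 * q)"
    proof (intro always_eventually allI)
      fix n
      have "real (N n ^ q) \<le> real (o_count M B q n +
          q * q * card M * (N n ^ (q - 1) * nat (2 * (K * int (Suc n)))))"
        using bounds(2)[of n] by (simp only: of_nat_le_iff)
      also have "\<dots> = real (o_count M B q n) + c * real (Suc n) * real (N n) ^ (q - 1)"
        using K(1) by (simp add: c_def mult_ac del: of_nat_Suc)
      finally have "\<nu> n ^ q * real (Suc n) ^ (2 * q) - c * real (Suc n) * (\<nu> n ^ (q - 1) * real (Suc n) ^ (2 * (q - 1)))
          \<le> real (o_count M B q n)"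
        by (simp add: pow del: of_nat_Suc)
      \<comment> \<open>Two factors \<open>real (Suc n)\<close> are split off: one cancels against
        the bound on attacks, the other remains as the decay of the error. The truncated subtraction
        \<open>q - 1\<close> requires \<open>q > 0\<close>.\<close>
      moreover have pow_q:
          "real (Suc n) ^ (2 * q) = real (Suc n) ^ (2 * (q - 1)) * real (Suc n) * real (Suc n)"
        using assms(4) by (cases q) (simp_all del: of_nat_Suc)
      have "(\<nu> n ^ q - c * \<nu> n ^ (q - 1) * inverse (real (Suc n))) * real (Suc n) ^ (2 * q) =
          \<nu> n ^ q * real (Suc n) ^ (2 * q) - c * real (Suc n) * (\<nu> n ^ (q - 1) * real (Suc n) ^
              (2 * (q - 1)))"
        unfolding pow_q by (simp add: field_simps del: of_nat_Suc)
      ultimately show "\<nu> n ^ q - c * \<nu> n ^ (q - 1) * inverse (real (Suc n))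
          \<le> real (o_count M B q n) / real (Suc n) ^ (2 * q)"
        by (simp only: pos_le_divide_eq zero_less_power of_nat_0_less_iff zero_less_Suc)
    qed
    show "\<forall>\<^sub>F n in sequentially. real (o_count M B q n) / real (Suc n) ^ (2 * q) \<le> \<nu> n ^ q"
    proof (intro always_eventually allI)
      fix n
      have "real (o_count M B q n) \<le> real (N n) ^ q"
        using bounds(1)[of n] by (metis of_nat_le_iff of_nat_power)
      then show "real (o_count M B q n) / real (Suc n) ^ (2 * q) \<le> \<nu> n ^ q"
        by (simp add: pow pos_divide_le_eq del: of_nat_Suc)
    qed
    show "(\<lambda>n. \<nu> n ^ q) \<longlonglongrightarrow> measure lebesgue B ^ q" by (intro tendsto_intros \<nu>)
    have "(\<lambda>n. \<nu> n ^ q - c * \<nu> n ^ (q - 1) * inverse (real (Suc n))) \<longlonglongrightarrow>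
        measure lebesgue B ^ q - c * measure lebesgue B ^ (q - 1) * 0"
      by (intro tendsto_intros \<nu> LIMSEQ_inverse_real_of_nat)
    then show "(\<lambda>n. \<nu> n ^ q - c * \<nu> n ^ (q - 1) * inverse (real (Suc n))) \<longlonglongrightarrow> measure lebesgue B ^ q"
      by simp
  qed
qed

subsection \<open>Constituents\<close>

text \<open>The limit is compared with that for the true degree. Any sequence tending to infinity
  suffices, so the criterion applies to a single residue class.\<close>

lemma poly_leading_coefficient_unique:
  fixes p :: "real poly"
  assumes x: "filterlim x at_top sequentially"
    and lim: "(\<lambda>k. poly p (x k) / x k ^ d) \<longlonglongrightarrow> c" and "c \<noteq> 0"
  shows "degree p = d \<and> lead_coeff p = c"
proof -
  have inf: "filterlim x at_infinity sequentially"
    using x by (rule filterlim_at_top_imp_at_infinity)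
  have lead: "(\<lambda>k. poly p (x k) / x k ^ degree p) \<longlonglongrightarrow> lead_coeff p"
    using filterlim_compose[OF poly_divide_tendsto_aux inf] .
  have pos: "\<forall>\<^sub>F k in sequentially. x k > 0"
    using x by (simp add: filterlim_at_top_dense)
  have small: "(\<lambda>k. inverse (x k) ^ m) \<longlonglongrightarrow> 0" if "m > 0" for m
    using tendsto_power[OF tendsto_inverse_0_at_top[OF x], of m] that by (simp only: zero_power)
  \<comment> \<open>Convergence for one exponent forces the limit 0 for every larger one, so two
    different exponents cannot both have nonzero limits.\<close>
  have ratio: "l = 0" if "(\<lambda>k. poly p (x k) / x k ^ i) \<longlonglongrightarrow> l'" "(\<lambda>k. poly p (x k) / x k ^ j) \<longlonglongrightarrow> l"
      "i < j"
    for i j l l'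
  proof -
    have "(\<lambda>k. poly p (x k) / x k ^ i * inverse (x k) ^ (j - i)) \<longlonglongrightarrow> l' * 0"
      using that by (intro tendsto_mult small) auto
    moreover have "\<forall>\<^sub>F k in sequentially. poly p (x k) / x k ^ i * inverse (x k) ^ (j - i) = poly p (x k) / x k ^ j"
      using pos
    proof eventually_elim
      case (elim k)
      have "x k ^ j = x k ^ i * x k ^ (j - i)" using that(3) by (simp flip: power_add)
      then show ?case using elim by (simp add: field_simps)
    qed
    ultimately have "(\<lambda>k. poly p (x k) / x k ^ j) \<longlonglongrightarrow> 0"
      by (simp add: tendsto_cong)
    then show "l = 0" using that(2) LIMSEQ_unique by blast
  qed
  consider "degree p < d" | "degree p = d" | "d < degree p" by linarith
  then show ?thesis
  proof cases
    case 1
    then show ?thesis using ratio[OF lead lim] assms(3) by blast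
  next
    case 2
    then show ?thesis using lead lim LIMSEQ_unique by blast
  next
    case 3
    then show ?thesis using ratio[OF lim lead] by auto
  qed
qed

text \<open>Positive area makes the limit of the scaled counts nonzero, as needed to read off the
  degree exactly.\<close>

lemma measure_rational_convex_polygon_pos:
  assumes "rational_convex_polygon B"
  shows "measure lebesgue B > 0"
proof -
  have B: "polytope B" "aff_dim B = 2" using assms by (auto simp: rational_convex_polygon_def)
  have "interior B = rel_interior B"
    using affine_hull_UNIV[of B] B(2) by (simp add: rel_interior_interior)
  moreover have "B \<noteq> {}" using B(2) by auto
  ultimately have "interior B \<noteq> {}"
    using polytope_imp_convex[OF B(1)] by (simp add: rel_interior_eq_empty)
  then have "\<not> negligible B"
    using polytope_imp_convex[OF B(1)] by (simp add: negligible_convex_interior)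
  moreover have "B \<in> lmeasurable"
    using polytope_imp_compact[OF B(1)] by (rule lmeasurable_compact)
  ultimately have "measure lebesgue B \<noteq> 0" by (simp add: negligible_iff_measure0)
  then show ?thesis by (simp add: less_le)
qed

theorem theorem4p1:
  fixes M :: "lattice_point set" and B :: "(real \<times> real) set" and q :: nat
  assumes "piece M" and "rational_convex_polygon B" and "q > 0"
  shows "\<exists>D e. quasipolynomial_rep D e (\<lambda>t. u_count M B q (t - 1)) \<and>
           quasipolynomial_degree D e = 2 * q \<and>
           (\<forall>r. coeff (constituent D e r) (2 * q) = measure lebesgue B ^ q / fact q)"
proof -
  obtain u where "quasipoly u" and u: "\<And>t. t > 0 \<Longrightarrow> real (o_count M B q (t - 1)) = u (int t)"
    using o_count_quasipoly[OF assms(1,2)] by blast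
  then obtain N p where N: "N > 0" and p: "\<And>x. u x = poly (p (x mod N)) (of_int x)"
    unfolding quasipoly_def by blast
  \<comment> \<open>The constituent polynomials: those of the labelled count, divided by
    \<open>fact q\<close>.\<close>
  define P where "P r = smult (1 / fact q) (p (int r mod N))" for r :: nat
  have P_periodic: "P (r + k * nat N) = P r" for r k
    using N by (simp add: P_def)
  have count: "u_count M B q (t - 1) = poly (P t) (real t)" if "t > 0" for t
    using that u[of t] by (simp add: u_count_def P_def p)
  have B: "bounded B" "convex B"
    using assms(2)
      by (auto simp: rational_convex_polygon_def polytope_imp_bounded polytope_imp_convex)
  have vol: "measure lebesgue B ^ q / fact q \<noteq> 0"
    using measure_rational_convex_polygon_pos[OF assms(2)] by simp
  have P: "degree (P r) = 2 * q \<and> lead_coeff (P r) = measure lebesgue B ^ q / fact q" for r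
  proof (rule poly_leading_coefficient_unique[OF _ _ vol])
    \<comment> \<open>The values \<open>t k = Suc (s k)\<close> run through the residue class of
      \<open>r\<close>, and \<open>s k\<close> is the matching \<open>n\<close>. Starting at
      \<open>r + nat N\<close> keeps \<open>t k\<close> positive for \<open>r = 0\<close> as
      well.\<close>
    define s where "s k = r + k * nat N + (nat N - 1)" for k
    have mono: "strict_mono s"
    proof (rule strict_monoI)
      fix k l :: nat assume "k < l"
      then have "k * nat N < l * nat N" using N by simp
      then show "s k < s l" by (simp add: s_def)
    qed
    define t where "t k = r + Suc k * nat N" for k
    have t_s: "t k = Suc (s k)" for k using N by (simp add: t_def s_def)
    have "filterlim t at_top sequentially"
      unfolding t_s using mono by (intro filterlim_subseq) (simp add: strict_mono_def)
    then show "filterlim (\<lambda>k. real (t k)) at_top sequentially"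
      by (rule filterlim_compose[OF filterlim_real_sequentially])
    have "(\<lambda>n. u_count M B q n / real (Suc n) ^ (2 * q)) \<longlonglongrightarrow> measure lebesgue B ^ q / fact q"
      using tendsto_divide[OF o_count_asymptotics[OF assms(1) B assms(3)] tendsto_const, of
          "fact q"]
      by (simp add: u_count_def mult.commute del: of_nat_Suc)
    from LIMSEQ_subseq_LIMSEQ[OF this mono]
    have "(\<lambda>k. u_count M B q (t k - 1) / real (t k) ^ (2 * q)) \<longlonglongrightarrow> measure lebesgue B ^ q / fact q"
      by (simp add: t_s o_def)
    moreover have "u_count M B q (t k - 1) = poly (P r) (real (t k))" for k
      using count[of "t k"] N P_periodic[of r "Suc k"] by (simp add: t_def)
    ultimately show "(\<lambda>k. poly (P r) (real (t k)) / real (t k) ^ (2 * q)) \<longlonglongrightarrow>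
        measure lebesgue B ^ q / fact q"
      by simp
  qed
  define e where "e j r = coeff (P r) j" for j r
  have "periodic (e j)" for j
    unfolding periodic_def using N P_periodic[of _ 1] by (intro exI[of _ "nat N"]) (simp add: e_def)
  moreover have "u_count M B q (t - 1) = (\<Sum>j\<le>2 * q. e j t * real t ^ j)" if "t > 0" for t
    using count[OF that] P[of t] by (simp add: e_def poly_altdef)
  ultimately have "quasipolynomial_rep (2 * q) e (\<lambda>t. u_count M B q (t - 1))"
    by (simp add: quasipolynomial_rep_def)
  \<comment> \<open>The degree of \<open>P r\<close> is \<open>2 * q\<close>, so the monomials up to
    that exponent recover all of it.\<close>
  moreover have constituent: "constituent (2 * q) e r = P r" for r
    unfolding constituent_def e_def using poly_as_sum_of_monoms[of "P r"] P[of r] by simp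
  have "quasipolynomial_degree (2 * q) e = 2 * q"
    using P by (simp add: quasipolynomial_degree_def constituent)
  moreover have "coeff (constituent (2 * q) e r) (2 * q) = measure lebesgue B ^ q / fact q" for r
    unfolding constituent using P[of r] by metis
  ultimately show ?thesis by blast
qed

end
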